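(* For an integer $n\ge 2$ let $\mathcal{S}_n$ be the class of functions $f:[n]\to\{0,1\}$ with $|\{i\in[n]:f(i)=1\}|\le n/5$. (1) There is an absolute constant $C$ such that for all $n$ and all $\epsilon\in(0,1)$ there is a two-sided error, non-adaptive, distribution-free query $\epsilon$-tester for $\mathcal{S}_n$ with query complexity at most $C/\epsilon^2$. (2) There are absolute constants $c>0$, $\epsilon_0>0$ such that for all $n\ge2$ and all $0<\epsilon<\epsilon_0$, every adaptive $(0,\epsilon)$-tolerant distribution-free tester for $\mathcal{S}_n$ has query complexity at least $c\cdot\frac{n}{\log n}$.
   Context: $[n]=\{1,\dots,n\}$. For a probability distribution $\mathcal{D}$ on $[n]$, $\mathrm{dist}_{\mathcal{D}}(f,g)=\Pr_{x\sim\mathcal{D}}[f(x)\ne g(x)]$ and $\mathrm{dist}_{\mathcal{D}}(f,\mathcal{H})=\min_{h\in\mathcal{H}}\mathrm{dist}_{\mathcal{D}}(f,h)$. A distribution-free query tester with query complexity $q$ is a (computationally unbounded) randomized algorithm that, for every unknown distribution $\mathcal{D}$ on $[n]$ and every unknown $f:[n]\to\{0,1\}$, may query $f$ at points of its choice and may request independent labelled samples $(x,f(x))$, $x\sim\mathcal{D}$, with the total number of queries plus samples at most $q$. It is non-adaptive if its queries do not depend on the answers to previous queries or samples, and adaptive if they may. It is an (intolerant) $\epsilon$-tester for $\mathcal{H}$ if it accepts with probability $\ge2/3$ whenever $f\in\mathcal{H}$ and rejects with probability $\ge2/3$ whenever $\mathrm{dist}_{\mathcal{D}}(f,\mathcal{H})>\epsilon$.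 It is a $(0,\epsilon)$-tolerant tester for $\mathcal{H}$ if it accepts with probability $\ge2/3$ whenever $\mathrm{dist}_{\mathcal{D}}(f,\mathcal{H})=0$ and rejects with probability $\ge2/3$ whenever $\mathrm{dist}_{\mathcal{D}}(f,\mathcal{H})\ge\epsilon$. *)

theory Defs
  imports "HOL-Probability.Probability"
begin

text \<open>
  The set \<open>[n]\<close> is \<open>{1..n}\<close> and the value set \<open>{0,1}\<close> is the type \<^typ>\<open>bool\<close>.
  Functions on \<open>[n]\<close> are extensional, so that classes of functions are finite sets and
  the minimum in the distance to a class is a \<^const>\<open>Min\<close>.
\<close>

definition bool_funs :: "nat \<Rightarrow> (nat \<Rightarrow> bool) set" where
  "bool_funs n = {1..n} \<rightarrow>\<^sub>E UNIV"

definition distributions :: "nat \<Rightarrow> nat pmf set" where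
  "distributions n = {D. set_pmf D \<subseteq> {1..n}}"

definition dist_fun :: "nat pmf \<Rightarrow> (nat \<Rightarrow> bool) \<Rightarrow> (nat \<Rightarrow> bool) \<Rightarrow> real" where
  "dist_fun D f g = measure_pmf.prob D {x. f x \<noteq> g x}"

definition dist_class :: "nat pmf \<Rightarrow> (nat \<Rightarrow> bool) \<Rightarrow> (nat \<Rightarrow> bool) set \<Rightarrow> real" where
  "dist_class D f H = Min (dist_fun D f ` H)"

definition small_class :: "nat \<Rightarrow> (nat \<Rightarrow> bool) set" where
  "small_class n = {f \<in> bool_funs n. real (card {i \<in> {1..n}. f i}) \<le> real n / 5}"

text \<open>
  A deterministic, computationally unbounded, adaptive algorithm is a decision tree: it stops
  with a verdict (\<^term>\<open>True\<close> means accept), queries \<open>f\<close> at a point and continues depending on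
  the answer, or draws a labelled sample and continues depending on the point and its label.
\<close>

datatype algorithm =
    Verdict bool
  | Query nat "bool \<Rightarrow> algorithm"
  | Sample "nat \<Rightarrow> bool \<Rightarrow> algorithm"

datatype request = Query_Request nat | Sample_Request

text \<open>
  The joint distribution of the sequence of requests made and the verdict given, when the
  unknown distribution is \<open>D\<close> and the unknown function is \<open>f\<close>.
\<close>

primrec exec :: "nat pmf \<Rightarrow> (nat \<Rightarrow> bool) \<Rightarrow> algorithm \<Rightarrow> (request list \<times> bool) pmf" where
  "exec D f (Verdict b) = return_pmf ([], b)"
| "exec D f (Query x k) = map_pmf (apfst (Cons (Query_Request x))) (exec D f (k (f x)))"
| "exec D f (Sample k) =
     bind_pmf D (\<lambda>x. map_pmf (apfst (Cons Sample_Request)) (exec D f (k x (f x))))"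

text \<open>
  A randomized algorithm draws all its internal randomness in advance, i.e. it is a probability
  distribution on deterministic algorithms. Discrete distributions lose no generality:
  on \<open>[n]\<close> and with a bounded number of requests there are only finitely many
  deterministic behaviours.
\<close>

type_synonym rand_algorithm = "algorithm pmf"

definition verdict_pmf :: "rand_algorithm \<Rightarrow> nat pmf \<Rightarrow> (nat \<Rightarrow> bool) \<Rightarrow> bool pmf" where
  "verdict_pmf T D f = bind_pmf T (\<lambda>A. map_pmf snd (exec D f A))"

definition accept_prob :: "rand_algorithm \<Rightarrow> nat pmf \<Rightarrow> (nat \<Rightarrow> bool) \<Rightarrow> real" where
  "accept_prob T D f = pmf (verdict_pmf T D f) True"

definition reject_prob :: "rand_algorithm \<Rightarrow> nat pmf \<Rightarrow> (nat \<Rightarrow> bool) \<Rightarrow> real" where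
  "reject_prob T D f = pmf (verdict_pmf T D f) False"

definition traces :: "nat \<Rightarrow> algorithm \<Rightarrow> request list set" where
  "traces n A = (\<Union>D \<in> distributions n. \<Union>f \<in> bool_funs n. fst ` set_pmf (exec D f A))"

text \<open>All queries are made at points of \<open>[n]\<close>, and their number plus that of samples is at most \<open>q\<close>.\<close>

definition query_algorithm :: "nat \<Rightarrow> nat \<Rightarrow> rand_algorithm \<Rightarrow> bool" where
  "query_algorithm n q T \<longleftrightarrow>
     (\<forall>A \<in> set_pmf T. \<forall>rs \<in> traces n A.
        length rs \<le> q \<and> (\<forall>x. Query_Request x \<in> set rs \<longrightarrow> x \<in> {1..n}))"

text \<open>
  Once the internal randomness is fixed, the whole sequence of requests is fixed, whatever the
  answers to queries and the samples are. Without this condition an algorithm is adaptive.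
\<close>

definition nonadaptive :: "nat \<Rightarrow> rand_algorithm \<Rightarrow> bool" where
  "nonadaptive n T \<longleftrightarrow> (\<forall>A \<in> set_pmf T. \<exists>rs. \<forall>rs' \<in> traces n A. rs' = rs)"

definition df_tester ::
    "nat \<Rightarrow> real \<Rightarrow> (nat \<Rightarrow> bool) set \<Rightarrow> nat \<Rightarrow> rand_algorithm \<Rightarrow> bool" where
  "df_tester n \<epsilon> H q T \<longleftrightarrow>
     query_algorithm n q T \<and>
     (\<forall>D \<in> distributions n. \<forall>f \<in> bool_funs n.
        (f \<in> H \<longrightarrow> accept_prob T D f \<ge> 2/3) \<and>
        (dist_class D f H > \<epsilon> \<longrightarrow> reject_prob T D f \<ge> 2/3))"

definition df_tolerant_tester ::
    "nat \<Rightarrow> real \<Rightarrow> (nat \<Rightarrow> bool) set \<Rightarrow> nat \<Rightarrow> rand_algorithm \<Rightarrow> bool" where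
  "df_tolerant_tester n \<epsilon> H q T \<longleftrightarrow>
     query_algorithm n q T \<and>
     (\<forall>D \<in> distributions n. \<forall>f \<in> bool_funs n.
        (dist_class D f H = 0 \<longrightarrow> accept_prob T D f \<ge> 2/3) \<and>
        (dist_class D f H \<ge> \<epsilon> \<longrightarrow> reject_prob T D f \<ge> 2/3))"

end

theory Submission
  imports Defs "HOL-Computational_Algebra.Polynomial" "HOL-Real_Asymp.Real_Asymp"
begin

text \<open>
  Upper bound: deleting the lightest ones of \<open>f\<close> shows that \<open>f\<close> can only be \<open>\<epsilon>\<close>-far from the class
  if its density of ones exceeds \<open>\<lfloor>n/5\<rfloor>/n\<close> by \<open>\<epsilon>/10\<close>, for every \<open>D\<close>; uniform queries detect this.

  Lower bound: for \<open>f \<equiv> 1\<close> the distance is 0 iff the support of \<open>D\<close> has at most \<open>n/5\<close> points, so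
  the task is a support size problem. The masses of \<open>N \<approx> 1.01 n/5\<close> points are drawn
  independently from \<open>A\<close> or from \<open>B\<close>, and the remaining mass is put on one extra point. Here \<open>A\<close>
  and \<open>B\<close> have equal moments of order below \<open>M \<approx> 2 ln n\<close> and values \<open>O(M\<^sup>2/n)\<close>, but only \<open>A\<close>
  charges 0. Changing one mass \<open>v\<close> from \<open>A\<close> to \<open>B\<close> changes the acceptance probability by at
  most \<open>e\<^sup>-\<^sup>M\<close>, since that probability is a polynomial in \<open>v\<close> whose \<open>k\<close>-th coefficient is at most
  \<open>2\<^sup>k (q choose k)\<close>; a hybrid argument over the \<open>N\<close> points finishes the proof.
\<close>

subsection \<open>Random variables with matching moments\<close>

text \<open>Pascal's rule: up to sign the sum is an iterated finite difference of \<open>f\<close>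
  at 0, so one order can be spent on passing to the first difference.\<close>

lemma alternating_binomial_sum_Suc:
  fixes f :: "nat \<Rightarrow> real"
  shows "(\<Sum>i\<le>Suc n. (-1)^i * real (Suc n choose i) * f i)
       = (\<Sum>i\<le>n. (-1)^i * real (n choose i) * (f i - f (Suc i)))"
proof -
  have "(\<Sum>i\<le>Suc n. (-1)^i * real (Suc n choose i) * f i)
      = f 0 + (\<Sum>i\<le>n. (-1)^Suc i * real (Suc n choose Suc i) * f (Suc i))"
    by (subst sum.atMost_Suc_shift) simp
  also have "(\<Sum>i\<le>n. (-1)^Suc i * real (Suc n choose Suc i) * f (Suc i))
      = (\<Sum>i\<le>n. (-1)^Suc i * real (n choose i) * f (Suc i))
        + (\<Sum>i\<le>n. (-1)^Suc i * real (n choose Suc i) * f (Suc i))"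
    by (simp add: algebra_simps sum_subtractf flip: sum.distrib sum_negf)
  also have "(\<Sum>i\<le>n. (-1)^Suc i * real (n choose Suc i) * f (Suc i))
      = (\<Sum>i\<le>Suc n. (-1)^i * real (n choose i) * f i) - f 0"
    by (subst sum.atMost_Suc_shift) simp
  also have "(\<Sum>i\<le>Suc n. (-1)^i * real (n choose i) * f i)
      = (\<Sum>i\<le>n. (-1)^i * real (n choose i) * f i)"
    by simp
  finally show ?thesis
    by (simp add: algebra_simps sum_subtractf sum_negf)
qed

text \<open>A first difference lowers the degree of a polynomial, so a difference of order
  \<open>n\<close> annihilates every power below \<open>n\<close>. The shift \<open>c\<close> later
  centres the sum.\<close>

lemma alternating_binomial_power_sum:
  fixes c :: real
  assumes "k < n"
  shows "(\<Sum>i\<le>n. (-1)^i * real (n choose i) * (real i + c)^k) = 0"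
  using assms
proof (induction n arbitrary: k)
  case (Suc n)
  have expand: "(real i + c)^k - (real (Suc i) + c)^k
      = (\<Sum>l<k. - real (k choose l) * (real i + c)^l)" for i
  proof -
    have "(real (Suc i) + c)^k = ((real i + c) + 1)^k"
      by (simp add: algebra_simps)
    also have "\<dots> = (\<Sum>l\<le>k. real (k choose l) * (real i + c)^l)"
      by (subst binomial_ring) simp
    also have "\<dots> = (\<Sum>l<k. real (k choose l) * (real i + c)^l) + (real i + c)^k"
      by (simp flip: lessThan_Suc_atMost)
    finally show ?thesis by (simp add: sum_negf)
  qed
  have "(\<Sum>i\<le>Suc n. (-1)^i * real (Suc n choose i) * (real i + c)^k)
     = (\<Sum>i\<le>n. \<Sum>l<k. - real (k choose l) * ((-1)^i * real (n choose i) * (real i + c)^l))"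
    unfolding alternating_binomial_sum_Suc[where f = "\<lambda>i. (real i + c)^k"] expand sum_distrib_left
    by (intro sum.cong refl) simp
  also have "\<dots> = (\<Sum>l<k. - real (k choose l) *
        (\<Sum>i\<le>n. (-1)^i * real (n choose i) * (real i + c)^l))"
    by (subst sum.swap) (simp add: sum_distrib_left)
  also have "\<dots> = 0"
    using Suc by (intro sum.neutral ballI) simp
  finally show ?case .
qed simp

text \<open>
  Dividing the weights by \<open>x - a\<close> makes them decay faster; a new node at \<open>a\<close> carrying the
  compensating weight keeps the moments zero.
\<close>

lemma vanishing_moments_insert_node:
  fixes u v x :: "'i \<Rightarrow> real"
  assumes "finite I" "j \<notin> I"
    and moments: "\<And>k. k < m \<Longrightarrow> (\<Sum>i\<in>I. u i * x i ^ k) = 0"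
    and neq: "\<And>i. i \<in> I \<Longrightarrow> x i \<noteq> x j"
    and v: "\<And>i. i \<in> I \<Longrightarrow> v i = u i / (x i - x j)"
    and vj: "v j = - (\<Sum>i\<in>I. v i)"
    and k: "k \<le> m"
  shows "(\<Sum>i\<in>insert j I. v i * x i ^ k) = 0"
  using k
proof (induction k)
  case 0
  show ?case using assms by simp
next
  case (Suc k)
  \<comment> \<open>Because \<open>u i = v i * (x i - x j)\<close>, the moment of \<open>v\<close>
    of order k+1 is that of \<open>u\<close> of order k, which vanishes, plus \<open>x j\<close>
    times that of \<open>v\<close> of order k.\<close>
  have split: "v i * x i ^ Suc k = u i * x i ^ k + x j * (v i * x i ^ k)" if "i \<in> I" for i
  proof -
    have "u i = v i * (x i - x j)" using that neq v by simp
    thus ?thesis by (simp only:) (simp add: algebra_simps)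
  qed
  have "(\<Sum>i\<in>insert j I. v i * x i ^ Suc k)
      = (\<Sum>i\<in>I. u i * x i ^ k) + x j * (\<Sum>i\<in>insert j I. v i * x i ^ k)"
    using assms(1,2)
    by (simp add: split sum.distrib sum_distrib_left algebra_simps del: power_Suc) 
      (simp add: algebra_simps)
  thus ?case using Suc moments by simp
qed

lemma sum_symmetric_squares:
  fixes h :: "real \<Rightarrow> real"
  shows "(\<Sum>i\<in>{..2*M} - {M}. h ((real i - real M)\<^sup>2)) = 2 * (\<Sum>j=1..M. h ((real j)\<^sup>2))"
proof -
  have set: "{..2*M} - {M} = (\<lambda>j. M - j) ` {1..M} \<union> (\<lambda>j. M + j) ` {1..M}"
  proof (intro equalityI subsetI)
    fix i assume "i \<in> {..2*M} - {M}"
    hence "i = M - (M - i) \<and> M - i \<in> {1..M} \<or> i = M + (i - M) \<and> i - M \<in> {1..M}"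
      by auto
    thus "i \<in> (\<lambda>j. M - j) ` {1..M} \<union> (\<lambda>j. M + j) ` {1..M}" by blast
  qed auto
  have "(\<Sum>i\<in>{..2*M} - {M}. h ((real i - real M)\<^sup>2))
     = (\<Sum>i\<in>(\<lambda>j. M - j) ` {1..M}. h ((real i - real M)\<^sup>2))
     + (\<Sum>i\<in>(\<lambda>j. M + j) ` {1..M}. h ((real i - real M)\<^sup>2))"
    unfolding set by (intro sum.union_disjoint) auto
  also have "(\<Sum>i\<in>(\<lambda>j. M - j) ` {1..M}. h ((real i - real M)\<^sup>2)) = (\<Sum>j=1..M. h ((real j)\<^sup>2))"
    by (subst sum.reindex) (auto simp: inj_on_def of_nat_diff intro!: sum.cong)
  also have "(\<Sum>i\<in>(\<lambda>j. M + j) ` {1..M}. h ((real i - real M)\<^sup>2)) = (\<Sum>j=1..M. h ((real j)\<^sup>2))"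
    by (subst sum.reindex) (auto simp: inj_on_def)
  finally show ?thesis by simp
qed

text \<open>The terms telescope, as \<open>j^2 - 1/4 = (j - 1/2) * (j + 1/2)\<close>.\<close>

lemma sum_inverse_square_minus_quarter_le:
  "(\<Sum>j=1..M. 1 / ((real j)\<^sup>2 - 1/4)) \<le> 2"
proof -
  have "(\<Sum>j=1..M. 1 / ((real j)\<^sup>2 - 1/4)) = 2 - 1 / (real M + 1/2)"
  proof (induction M)
    case (Suc M)
    have fac: "(real (Suc M))\<^sup>2 - 1/4 = (real M + 1/2) * (real M + 3/2)"
      by (simp add: power2_eq_square algebra_simps)
    have "1 / ((real M + 1/2) * (real M + 3/2)) = 1 / (real M + 1/2) - 1 / (real M + 3/2)"
      by (simp add: divide_simps)
    moreover have "real (Suc M) + 1/2 = real M + 3/2" by simp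
    ultimately show ?case using Suc by (simp add: fac del: of_nat_Suc)
  qed simp
  thus ?thesis by simp
qed

text \<open>
  The weights \<open>(-1)\<^sup>j C(2M, M+j)\<close> at the squares \<open>j\<^sup>2\<close> have vanishing moments by finite differences.
  Inserting the nodes \<open>1/4\<close> and \<open>1/2\<close> makes the weights decay like \<open>j\<^sup>-\<^sup>4\<close>, so that total mass and
  first absolute moment are bounded independently of \<open>M\<close>.
\<close>

lemma ex_signed_measure_vanishing_moments:
  assumes "M \<ge> 1"
  obtains I and w x :: "nat \<Rightarrow> real" and i0 where
    "finite I"
    "\<And>k. k < M \<Longrightarrow> (\<Sum>i\<in>I. w i * x i ^ k) = 0"
    "i0 \<in> I" "w i0 = 8" "x i0 = 0"
    "\<And>i. i \<in> I \<Longrightarrow> i \<noteq> i0 \<Longrightarrow> 1/4 \<le> x i"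
    "\<And>i. i \<in> I \<Longrightarrow> x i \<le> (real M)\<^sup>2"
    "(\<Sum>i\<in>I. \<bar>w i\<bar>) \<le> 96"
    "(\<Sum>i\<in>I. \<bar>w i\<bar> * x i) \<le> 40"
proof -
  \<comment> \<open>Indices up to \<open>2*M\<close> run through the squares symmetrically about
    \<open>M\<close>, each nonzero square twice; \<open>2*M+1\<close> and \<open>2*M+2\<close> are
    the inserted nodes. Division by the central binomial coefficient gives the node 0 weight 1 and
    every other square at most 1 in absolute value.\<close>
  define x where "x i = (if i \<le> 2*M then (real i - real M)\<^sup>2 else if i = 2*M+1 then 1/4 else 1/2)" for i
  define b where "b i = real (2*M choose i) / real (2*M choose M)" for i
  define u where "u i = (-1)^(i+M) * b i" for i
  define c where "c = - (\<Sum>i\<le>2*M. u i / (x i - 1/4))"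
  define v where "v i = (if i \<le> 2*M then u i / (x i - 1/4) else c)" for i
  define d where "d = - (\<Sum>i\<le>2*M+1. v i / (x i - 1/2))"
  define w where "w i = (if i \<le> 2*M+1 then v i / (x i - 1/2) else d)" for i
  define J where "J = {..2*M} - {M}"
  have fJ: "finite J" and MJ: "M \<notin> J" and JM: "{..2*M} = insert M J"
    by (auto simp: J_def)
  have bM: "b M = 1" by (simp add: b_def)
  have b: "0 \<le> b i" "b i \<le> 1" for i
    using binomial_maximum'[of M i] by (auto simp: b_def field_simps)
  have absu: "\<bar>u i\<bar> = b i" for i
    using b[of i] by (simp add: u_def abs_mult power_abs)
  have uM: "u M = 1" by (simp add: u_def bM)
  have xM: "x M = 0" by (simp add: x_def)
  have xJ: "x i \<ge> 1" "x i \<le> (real M)\<^sup>2" if "i \<in> J" for i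
  proof -
    have "1 \<le> \<bar>real i - real M\<bar>" "\<bar>real i - real M\<bar> \<le> real M" using that by (auto simp: J_def)
    hence "1\<^sup>2 \<le> \<bar>real i - real M\<bar>\<^sup>2" "\<bar>real i - real M\<bar>\<^sup>2 \<le> (real M)\<^sup>2"
      by (intro power_mono; simp)+
    thus "x i \<ge> 1" "x i \<le> (real M)\<^sup>2" using that by (auto simp: x_def J_def)
  qed
  \<comment> \<open>Majorant of the weights after the first division. By symmetry and telescoping
    its sum over \<open>J\<close> is at most 4 for every \<open>M\<close>. The second division costs
    a factor of at most 2, even after multiplication by the node, since nodes in \<open>J\<close>
    are at least 1.\<close>
  define t where "t i = 1 / (x i - 1/4)" for i
  have t_nonneg: "t i \<ge> 0" if "i \<in> J" for i using xJ[OF that] by (simp add: t_def)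
  have sum_t: "(\<Sum>i\<in>J. t i) \<le> 4"
  proof -
    have "(\<Sum>i\<in>J. t i) = (\<Sum>i\<in>J. 1 / ((real i - real M)\<^sup>2 - 1/4))"
      by (intro sum.cong) (auto simp: J_def t_def x_def)
    also have "\<dots> \<le> 4"
      unfolding J_def using sum_symmetric_squares[of "\<lambda>y. 1 / (y - 1/4)" M]
        sum_inverse_square_minus_quarter_le[of M] by simp
    finally show ?thesis .
  qed

  \<comment> \<open>The k-th power of a node is a polynomial in i of degree 2k < 2M, which a
    difference of order 2M annihilates.\<close>
  have mom_u: "(\<Sum>i\<in>{..2*M}. u i * x i ^ k) = 0" if "k < M" for k
  proof -
    have "(\<Sum>i\<in>{..2*M}. u i * x i ^ k) = (\<Sum>i\<le>2*M. ((-1)^M / real (2*M choose M)) *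
        ((-1)^i * real (2*M choose i) * (real i + - real M)^(2*k)))"
      by (intro sum.cong) (auto simp: u_def b_def x_def power_add power_mult)
    also have "\<dots> = 0"
      using alternating_binomial_power_sum[of "2*k" "2*M" "- real M"] that
      unfolding sum_distrib_left[symmetric] by simp
    finally show ?thesis .
  qed
  have neq4: "x i \<noteq> 1/4" "x i \<noteq> 1/2" if "i \<le> 2*M" for i
    using that xJ(1)[of i] xM by (cases "i = M"; force simp: J_def)+
  have ins1: "{..2*M+1} = insert (2*M+1) {..2*M}" and ins2: "{..2*M+2} = insert (2*M+2) {..2*M+1}"
    by auto
  have mom_v: "(\<Sum>i\<in>{..2*M+1}. v i * x i ^ k) = 0" if "k < M" for k
    unfolding ins1
    by (rule vanishing_moments_insert_node[where m = M and u = u])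
       (use mom_u neq4 that in \<open>auto simp: v_def x_def c_def\<close>)
  have neq2: "x i \<noteq> 1/2" if "i \<le> 2*M+1" for i
    using neq4[of i] that by (cases "i \<le> 2*M") (auto simp: x_def)
  have mom_w: "(\<Sum>i\<in>{..2*M+2}. w i * x i ^ k) = 0" if "k < M" for k
    unfolding ins2
    by (rule vanishing_moments_insert_node[where m = M and u = v])
       (use mom_v neq2 that in \<open>auto simp: w_def x_def d_def\<close>)

  have vM: "v M = - 4" by (simp add: v_def uM xM)
  have wM: "w M = 8" by (simp add: w_def vM xM)
  have vJ: "\<bar>v i\<bar> \<le> t i" if "i \<in> J" for i
    using that b[of i] xJ[OF that]
    by (auto simp: v_def t_def abs_mult absu J_def divide_simps)
  have c: "\<bar>c\<bar> \<le> 8"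
  proof -
    have "c = - (\<Sum>i\<le>2*M. v i)"
      by (auto simp: c_def v_def intro!: sum.cong)
    hence "c = - (v M + (\<Sum>i\<in>J. v i))"
      by (simp only: JM sum.insert[OF fJ MJ])
    moreover have "\<bar>\<Sum>i\<in>J. v i\<bar> \<le> (\<Sum>i\<in>J. t i)"
      by (rule order_trans[OF sum_abs]) (intro sum_mono vJ)
    ultimately show ?thesis using sum_t vM by linarith
  qed
  have wJ: "\<bar>w i\<bar> = \<bar>v i\<bar> / (x i - 1/2)" if "i \<in> J" for i
    using that xJ[OF that] by (auto simp: w_def J_def abs_mult)
  have wJ1: "\<bar>w i\<bar> \<le> 2 * t i" if "i \<in> J" for i
  proof -
    have "\<bar>v i\<bar> / (x i - 1/2) \<le> t i / (1/2)"
      using that xJ[OF that] vJ[OF that] by (intro frac_le) auto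
    thus ?thesis using wJ[OF that] by simp
  qed
  have wJ2: "\<bar>w i\<bar> * x i \<le> 2 * t i" if "i \<in> J" for i
  proof -
    have "x i / (x i - 1/2) \<le> 2" using xJ[OF that] by (simp add: divide_simps)
    hence "\<bar>v i\<bar> * (x i / (x i - 1/2)) \<le> t i * 2"
      using vJ[OF that] xJ[OF that] t_nonneg[OF that] by (intro mult_mono) auto
    thus ?thesis using wJ[OF that] by simp
  qed
  \<comment> \<open>Dividing \<open>c\<close> by \<open>1/4 - 1/2\<close> costs a factor 4. With 8
    at the node 0 and 8 on \<open>J\<close> this makes 48; the weight at 1/2 at most doubles it to
    96. The first moment is at most 8 + 32/4 + 48/2 = 40.\<close>
  have wa: "\<bar>w (2*M+1)\<bar> \<le> 32" using c by (simp add: w_def v_def x_def abs_mult)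
  have SJ1: "(\<Sum>i\<in>J. \<bar>w i\<bar>) \<le> 8"
    using sum_mono[of J "\<lambda>i. \<bar>w i\<bar>" "\<lambda>i. 2 * t i", OF wJ1] sum_t
    by (simp flip: sum_distrib_left)
  have SJ2: "(\<Sum>i\<in>J. \<bar>w i\<bar> * x i) \<le> 8"
    using sum_mono[of J "\<lambda>i. \<bar>w i\<bar> * x i" "\<lambda>i. 2 * t i", OF wJ2] sum_t
    by (simp flip: sum_distrib_left)
  have split: "(\<Sum>i\<le>2*M+1. f i) = f (2*M+1) + (f M + (\<Sum>i\<in>J. f i))" for f :: "nat \<Rightarrow> real"
  proof -
    have "(\<Sum>i\<le>2*M+1. f i) = f (2*M+1) + (\<Sum>i\<le>2*M. f i)" by simp
    thus ?thesis by (simp only: JM sum.insert[OF fJ MJ])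
  qed
  have S1: "(\<Sum>i\<le>2*M+1. \<bar>w i\<bar>) \<le> 48"
    unfolding split using SJ1 wa wM by simp
  have wb: "\<bar>w (2*M+2)\<bar> \<le> 48"
  proof -
    have "w (2*M+2) = - (\<Sum>i\<le>2*M+1. w i)"
      by (auto simp: w_def d_def intro!: sum.cong)
    thus ?thesis using S1 sum_abs[of w "{..2*M+1}"] by linarith
  qed
  show ?thesis
  proof (rule that[of "{..2*M+2}" w x M])
    show "(\<Sum>i\<le>2*M+2. \<bar>w i\<bar>) \<le> 96"
      unfolding ins2 using S1 wb by simp
    have "(\<Sum>i\<le>2*M+1. \<bar>w i\<bar> * x i) \<le> 16"
      unfolding split using SJ2 wa wM xM by (simp add: x_def)
    thus "(\<Sum>i\<le>2*M+2. \<bar>w i\<bar> * x i) \<le> 40"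
      unfolding ins2 using wb by (simp add: x_def)
    show "1/4 \<le> x i" if "i \<in> {..2*M+2}" "i \<noteq> M" for i
      using that xJ(1)[of i] by (cases "i \<in> J") (auto simp: J_def x_def)
    have "1 \<le> (real M)\<^sup>2" using assms by simp
    thus "x i \<le> (real M)\<^sup>2" if "i \<in> {..2*M+2}" for i
      using that xJ(2)[of i] xM by (cases "i \<in> J"; cases "i = M") (auto simp: J_def x_def)
  qed (use mom_w wM xM in auto)
qed

lemma ex_pmf_weights:
  fixes g :: "'i \<Rightarrow> real"
  assumes "finite I" "\<And>i. i \<in> I \<Longrightarrow> g i \<ge> 0" "(\<Sum>i\<in>I. g i) = 1"
  obtains p where "\<And>i. pmf p i = (if i \<in> I then g i else 0)" "set_pmf p \<subseteq> I"
proof -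
  let ?g = "\<lambda>i. if i \<in> I then g i else 0"
  have "(\<integral>\<^sup>+i. ennreal (?g i) \<partial>count_space UNIV) = (\<Sum>i\<in>I. ennreal (?g i))"
    by (rule nn_integral_count_space'[OF assms(1)]) auto
  also have "\<dots> = ennreal (\<Sum>i\<in>I. g i)"
    using assms by (subst sum_ennreal[symmetric]) auto
  finally have 1: "(\<integral>\<^sup>+i. ennreal (?g i) \<partial>count_space UNIV) = 1" using assms by simp
  have "pmf (embed_pmf ?g) i = ?g i" for i
    by (rule pmf_embed_pmf) (use 1 assms in auto)
  thus ?thesis
    by (intro that[of "embed_pmf ?g"]) (auto simp: set_pmf_iff split: if_splits)
qed

text \<open>\<open>A\<close> and \<open>B\<close> are the normalised positive and negative parts of
  the signed measure; its zeroth moment gives both the same mass S, with 8 \<le> S \<le> 96. The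
  node 0 has the positive weight 8, so only \<open>A\<close> charges it, with mass at least 8/96.
  The means are at most 40/8.\<close>

lemma ex_pmfs_matching_moments:
  assumes "M \<ge> 1"
  obtains A B :: "real pmf" where
    "finite (set_pmf A)" "finite (set_pmf B)"
    "set_pmf A \<subseteq> {0..(real M)\<^sup>2}" "set_pmf B \<subseteq> {1/4..(real M)\<^sup>2}"
    "pmf A 0 \<ge> 1/12"
    "\<And>k. k < M \<Longrightarrow> measure_pmf.expectation A (\<lambda>y. y ^ k) = measure_pmf.expectation B (\<lambda>y. y ^ k)"
    "measure_pmf.expectation A (\<lambda>y. y) \<le> 5" "measure_pmf.expectation B (\<lambda>y. y) \<le> 5"
proof -
  obtain I and w x :: "nat \<Rightarrow> real" and i0 where
    I: "finite I" and w: "\<And>k. k < M \<Longrightarrow> (\<Sum>i\<in>I. w i * x i ^ k) = 0"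
    "i0 \<in> I" "w i0 = 8" "x i0 = 0"
    "\<And>i. i \<in> I \<Longrightarrow> i \<noteq> i0 \<Longrightarrow> 1/4 \<le> x i"
    "\<And>i. i \<in> I \<Longrightarrow> x i \<le> (real M)\<^sup>2"
    "(\<Sum>i\<in>I. \<bar>w i\<bar>) \<le> 96"
    "(\<Sum>i\<in>I. \<bar>w i\<bar> * x i) \<le> 40"
    by (rule ex_signed_measure_vanishing_moments[OF assms]) blast
  define S where "S = (\<Sum>i\<in>I. max (w i) 0)"
  have x0: "x i \<ge> 0" if "i \<in> I" for i using w(4) w(5)[of i] that by fastforce
  have S8: "S \<ge> 8"
    using member_le_sum[of i0 I "\<lambda>i. max (w i) 0"] w(2,3) I by (simp add: S_def)
  have S96: "S \<le> 96"
    unfolding S_def by (rule order_trans[OF sum_mono w(7)]) simp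
  have eq: "(\<Sum>i\<in>I. max (w i) 0 * x i ^ k) = (\<Sum>i\<in>I. max (- w i) 0 * x i ^ k)" if "k < M" for k
  proof -
    have "(\<Sum>i\<in>I. max (w i) 0 * x i ^ k) - (\<Sum>i\<in>I. max (- w i) 0 * x i ^ k)
        = (\<Sum>i\<in>I. w i * x i ^ k)"
      by (subst sum_subtractf[symmetric]) (auto intro!: sum.cong simp: max_def)
    thus ?thesis using w(1)[OF that] by simp
  qed
  have S': "(\<Sum>i\<in>I. max (- w i) 0) = S"
    using eq[of 0] assms by (simp add: S_def)
  obtain p where p: "\<And>i. pmf p i = (if i \<in> I then max (w i) 0 / S else 0)" "set_pmf p \<subseteq> I"
    by (rule ex_pmf_weights[of I "\<lambda>i. max (w i) 0 / S"])
       (use I S8 in \<open>auto simp: S_def simp flip: sum_divide_distrib\<close>)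
  obtain r where r: "\<And>i. pmf r i = (if i \<in> I then max (- w i) 0 / S else 0)" "set_pmf r \<subseteq> I"
    by (rule ex_pmf_weights[of I "\<lambda>i. max (- w i) 0 / S"])
       (use I S8 S' in \<open>auto simp flip: sum_divide_distrib\<close>)
  have Ep: "measure_pmf.expectation (map_pmf x p) f = (\<Sum>i\<in>I. max (w i) 0 * f (x i)) / S"
    for f :: "real \<Rightarrow> real"
    by (subst integral_map_pmf, subst integral_measure_pmf_real[of I])
       (use I p in \<open>auto simp: sum_divide_distrib mult.commute\<close>)
  have Er: "measure_pmf.expectation (map_pmf x r) f = (\<Sum>i\<in>I. max (- w i) 0 * f (x i)) / S"
    for f :: "real \<Rightarrow> real"
    by (subst integral_map_pmf, subst integral_measure_pmf_real[of I])
       (use I r in \<open>auto simp: sum_divide_distrib mult.commute\<close>)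
  have mean: "(\<Sum>i\<in>I. max (w i) 0 * x i) \<le> 40" "(\<Sum>i\<in>I. max (- w i) 0 * x i) \<le> 40"
    using sum_mono[of I "\<lambda>i. max (w i) 0 * x i" "\<lambda>i. \<bar>w i\<bar> * x i"]
      sum_mono[of I "\<lambda>i. max (- w i) 0 * x i" "\<lambda>i. \<bar>w i\<bar> * x i"] w(8) x0
    by (force intro: mult_right_mono)+
  have i0: "i0 \<notin> set_pmf r" using r(1)[of i0] w(3) by (simp add: set_pmf_iff)
  show ?thesis
  proof (rule that[of "map_pmf x p" "map_pmf x r"])
    show "finite (set_pmf (map_pmf x p))" "finite (set_pmf (map_pmf x r))"
      using finite_subset[OF p(2) I] finite_subset[OF r(2) I] by simp_all
    show "set_pmf (map_pmf x p) \<subseteq> {0..(real M)\<^sup>2}" using p(2) x0 w(6) by auto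
    show "set_pmf (map_pmf x r) \<subseteq> {1/4..(real M)\<^sup>2}"
    proof -
      have "x i \<in> {1/4..(real M)\<^sup>2}" if "i \<in> set_pmf r" for i
      proof -
        have "i \<in> I" "i \<noteq> i0" using that r(2) i0 by auto
        thus ?thesis using w(5,6) by simp
      qed
      thus ?thesis by auto
    qed
    have "1/12 \<le> 8 / S" using S96 S8 by (simp add: field_simps)
    also have "8 / S = measure_pmf.prob p {i0}"
      using w(2,3) by (simp add: measure_pmf_single p(1))
    also have "\<dots> \<le> measure_pmf.prob p (x -` {0})"
      by (rule measure_pmf.finite_measure_mono) (use w(4) in auto)
    finally show "pmf (map_pmf x p) 0 \<ge> 1/12" by (simp add: pmf_map)
    show "measure_pmf.expectation (map_pmf x p) (\<lambda>y. y ^ k)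
        = measure_pmf.expectation (map_pmf x r) (\<lambda>y. y ^ k)" if "k < M" for k
      unfolding Ep Er using eq[OF that] by simp
    show "measure_pmf.expectation (map_pmf x p) (\<lambda>y. y) \<le> 5"
      unfolding Ep using mean(1) S8 by (simp add: field_simps)
    show "measure_pmf.expectation (map_pmf x r) (\<lambda>y. y) \<le> 5"
      unfolding Er using mean(2) S8 by (simp add: field_simps)
  qed
qed

subsection \<open>The non-adaptive tester\<close>

primrec poll :: "real \<Rightarrow> nat list \<Rightarrow> nat \<Rightarrow> algorithm" where
  "poll t [] c = Verdict (real c \<le> t)"
| "poll t (x # xs) c = Query x (\<lambda>b. poll t xs (if b then Suc c else c))"

text \<open>Answers affect only the counter, so the requests are fixed once \<open>xs\<close> is
  drawn; this is what makes the tester non-adaptive.\<close>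

lemma exec_poll:
  "exec D f (poll t xs c) =
     return_pmf (map Query_Request xs, real (c + length (filter f xs)) \<le> t)"
  by (induction xs arbitrary: c) (simp_all add: add_ac)

lemma map_replicate_pmf:
  "map_pmf (map f) (replicate_pmf n p) = replicate_pmf n (map_pmf f p)"
proof (induction n)
  case (Suc n)
  have "map_pmf (map f) (replicate_pmf (Suc n) p)
      = bind_pmf p (\<lambda>x. bind_pmf (map_pmf (map f) (replicate_pmf n p)) (\<lambda>ys. return_pmf (f x # ys)))"
    by (simp add: map_bind_pmf bind_map_pmf map_pmf_def bind_assoc_pmf bind_return_pmf)
  also have "\<dots> = replicate_pmf (Suc n) (map_pmf f p)"
    by (simp add: Suc bind_map_pmf)
  finally show ?case .
qed simp

lemma map_pmf_of_set_bernoulli: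
  assumes "finite A" "A \<noteq> {}"
  shows "map_pmf f (pmf_of_set A) = bernoulli_pmf (real (card {x\<in>A. f x}) / real (card A))"
proof (rule pmf_eqI)
  fix b
  let ?p = "real (card {x\<in>A. f x}) / real (card A)"
  have le: "card {x\<in>A. f x} \<le> card A" using assms by (intro card_mono) auto
  have p: "?p \<in> {0..1}" using le assms by (auto simp: divide_le_eq_1 card_gt_0_iff)
  have T: "pmf (map_pmf f (pmf_of_set A)) True = ?p"
    using assms by (simp add: pmf_map measure_pmf_of_set vimage_def Int_def)
  have "pmf (map_pmf f (pmf_of_set A)) False = 1 - ?p"
    using pmf_False_conv_True[of "map_pmf f (pmf_of_set A)"] T by simp
  with T p show "pmf (map_pmf f (pmf_of_set A)) b = pmf (bernoulli_pmf ?p) b"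
    by (cases b) simp_all
qed

definition poll_tester :: "nat \<Rightarrow> nat \<Rightarrow> real \<Rightarrow> rand_algorithm" where
  "poll_tester n N t = map_pmf (\<lambda>xs. poll t xs 0) (replicate_pmf N (pmf_of_set {1..n}))"

text \<open>Independent uniform queries are answered by independent coins whose bias is the density
  of ones, which makes binomial tail bounds applicable.\<close>

lemma verdict_poll_tester:
  assumes "n \<ge> 1"
  shows "verdict_pmf (poll_tester n N t) D f =
    map_pmf (\<lambda>c. real c \<le> t) (binomial_pmf N (real (card {i\<in>{1..n}. f i}) / real n))"
proof -
  let ?p = "real (card {i\<in>{1..n}. f i}) / real n"
  have "card {i\<in>{1..n}. f i} \<le> card {1..n}" by (intro card_mono) auto
  hence p: "?p \<in> {0..1}" using assms by (auto simp: divide_le_eq_1)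
  have len: "length (filter f xs) = length (filter id (map f xs))" for xs
    by (induction xs) auto
  have "verdict_pmf (poll_tester n N t) D f
      = map_pmf (\<lambda>xs. real (length (filter id (map f xs))) \<le> t) (replicate_pmf N (pmf_of_set {1..n}))"
    by (simp add: verdict_pmf_def poll_tester_def bind_map_pmf exec_poll flip: len)
      (simp add: map_pmf_def)
  also have "\<dots> = map_pmf (\<lambda>bs. real (length (filter id bs)) \<le> t)
      (map_pmf (map f) (replicate_pmf N (pmf_of_set {1..n})))"
    by (simp add: pmf.map_comp o_def)
  also have "map_pmf (map f) (replicate_pmf N (pmf_of_set {1..n})) = replicate_pmf N (bernoulli_pmf ?p)"
    using assms by (simp add: map_replicate_pmf map_pmf_of_set_bernoulli)
  also have "map_pmf (\<lambda>bs. real (length (filter id bs)) \<le> t) (replicate_pmf N (bernoulli_pmf ?p))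
      = map_pmf (\<lambda>c. real c \<le> t) (binomial_pmf N ?p)"
    unfolding binomial_pmf_altdef[OF p] by (simp add: pmf.map_comp o_def)
  finally show ?thesis .
qed

lemma poll_tester_requests:
  assumes "n \<ge> 1" "A \<in> set_pmf (poll_tester n N t)"
  obtains xs where "set xs \<subseteq> {1..n}" "length xs = N" "traces n A \<subseteq> {map Query_Request xs}"
proof -
  from assms obtain xs where xs: "xs \<in> set_pmf (replicate_pmf N (pmf_of_set {1..n}))" "A = poll t xs 0"
    by (auto simp: poll_tester_def)
  thus ?thesis
    using assms(1) by (intro that[of xs]) (auto simp: set_replicate_pmf traces_def exec_poll)
qed

section \<open>Distance to the class and density of ones\<close>

text \<open>The average over the \<open>j\<close> lightest elements is at most the average over
  \<open>S\<close>. The induction discards a heaviest element \<open>a\<close>; as each element of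
  \<open>K\<close> weighs at most \<open>g a\<close>, the \<open>j\<close> kept ones weigh at most
  \<open>j * g a\<close>, which pays for raising the factor \<open>card ?S\<close> by 1.\<close>

lemma light_subset_exists:
  fixes g :: "'a \<Rightarrow> real"
  assumes "finite S" "\<And>x. x \<in> S \<Longrightarrow> g x \<ge> 0" "j \<le> card S"
  shows "\<exists>K\<subseteq>S. card K = j \<and> real (card S) * (\<Sum>x\<in>K. g x) \<le> real j * (\<Sum>x\<in>S. g x)"
  using assms
proof (induction "card S - j" arbitrary: S)
  case 0
  thus ?case by (intro exI[of _ S]) auto
next
  case (Suc d)
  hence "S \<noteq> {}" by auto
  have "Max (g ` S) \<in> g ` S" using Suc(3) \<open>S \<noteq> {}\<close> by (intro Max_in) auto
  then obtain a where a: "a \<in> S" "Max (g ` S) = g a" by blast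
  have max: "g x \<le> g a" if "x \<in> S" for x
    using a(2) Suc(3) that by (metis Max_ge finite_imageI imageI)
  let ?S = "S - {a}"
  have "card S = Suc (card ?S)" using a(1) Suc(3) by (rule card.remove[rotated])
  hence card: "real (card S) = real (card ?S) + 1" "card S = Suc (card ?S)" by linarith+
  have "\<exists>K\<subseteq>?S. card K = j \<and> real (card ?S) * (\<Sum>x\<in>K. g x) \<le> real j * (\<Sum>x\<in>?S. g x)"
  proof (rule Suc(1))
    show "d = card ?S - j" "j \<le> card ?S" using Suc(2) card(2) by linarith+
  qed (use Suc(3,4) in auto)
  then obtain K where K: "K \<subseteq> ?S" "card K = j"
      "real (card ?S) * (\<Sum>x\<in>K. g x) \<le> real j * (\<Sum>x\<in>?S. g x)" by blast
  have "(\<Sum>x\<in>K. g x) \<le> (\<Sum>x\<in>K. g a)" using K(1) max by (intro sum_mono) auto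
  hence "(\<Sum>x\<in>K. g x) \<le> real j * g a" using K(2) by simp
  hence "real (card S) * (\<Sum>x\<in>K. g x) \<le> real j * ((\<Sum>x\<in>?S. g x) + g a)"
    using K(3) unfolding card(1) by (simp add: algebra_simps)
  also have "(\<Sum>x\<in>?S. g x) + g a = (\<Sum>x\<in>S. g x)"
    using a(1) Suc(3) by (simp add: sum.remove)
  finally show ?case using K by blast
qed

lemma finite_bool_funs: "finite (bool_funs n)"
  by (simp add: bool_funs_def finite_PiE)

lemma finite_small_class: "finite (small_class n)"
  using finite_bool_funs by (simp add: small_class_def)

lemma dist_class_le: "h \<in> small_class n \<Longrightarrow> dist_class D f (small_class n) \<le> dist_fun D f h"
  by (simp add: dist_class_def finite_small_class)

text \<open>Turning the lightest ones of \<open>f\<close> into zeros until \<open>n div 5\<close>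
  ones are left, the most that the class allows, changes at most a proportional share of the mass of
  the ones, which is at most 1.\<close>

lemma dist_class_small_class_le:
  assumes D: "D \<in> distributions n" and f: "f \<in> bool_funs n"
    and k: "real (card {i\<in>{1..n}. f i}) > real n / 5"
  shows "real (card {i\<in>{1..n}. f i}) * dist_class D f (small_class n)
       \<le> real (card {i\<in>{1..n}. f i} - n div 5)"
proof -
  define S where "S = {i\<in>{1..n}. f i}"
  have fS: "finite S" by (simp add: S_def)
  have mk: "n div 5 \<le> card S" using k by (simp add: S_def)
  have "\<exists>K\<subseteq>S. card K = card S - n div 5 \<and>
      real (card S) * (\<Sum>x\<in>K. pmf D x) \<le> real (card S - n div 5) * (\<Sum>x\<in>S. pmf D x)"
    by (rule light_subset_exists) (use fS in auto)
  then obtain K where K: "K \<subseteq> S" "card K = card S - n div 5"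
      "real (card S) * (\<Sum>x\<in>K. pmf D x) \<le> real (card S - n div 5) * (\<Sum>x\<in>S. pmf D x)"
    by blast
  have fK: "finite K" using K(1) fS by (rule finite_subset)
  define h where "h = (\<lambda>i. if i \<in> K then False else f i)"
  have "{i\<in>{1..n}. h i} = S - K" by (auto simp: h_def S_def)
  hence "card {i\<in>{1..n}. h i} = n div 5"
    using K mk fK by (simp add: card_Diff_subset)
  hence h: "h \<in> small_class n"
    using f K(1) by (auto simp: small_class_def bool_funs_def h_def S_def PiE_def extensional_def)
  have diff: "{x. f x \<noteq> h x} \<subseteq> K" by (auto simp: h_def)
  have "dist_class D f (small_class n) \<le> dist_fun D f h" by (rule dist_class_le[OF h])
  also have "\<dots> \<le> measure_pmf.prob D K"
    unfolding dist_fun_def using diff by (intro measure_pmf.finite_measure_mono) auto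
  also have "\<dots> = (\<Sum>x\<in>K. pmf D x)" by (rule measure_measure_pmf_finite[OF fK])
  finally have "real (card S) * dist_class D f (small_class n) \<le> real (card S) * (\<Sum>x\<in>K. pmf D x)"
    by (intro mult_left_mono) auto
  also note K(3)
  also have "real (card S - n div 5) * (\<Sum>x\<in>S. pmf D x) \<le> real (card S - n div 5) * 1"
    using measure_measure_pmf_finite[OF fS, of D, symmetric] by (intro mult_left_mono) auto
  finally show ?thesis by (simp add: S_def)
qed

text \<open>By \<open>dist_class_small_class_le\<close> the excess over \<open>n div 5\<close> is at
  least \<epsilon> times the number of ones, and a function outside the class has more than
  \<open>n/5\<close> of them.\<close>

lemma far_density_gap:
  assumes D: "D \<in> distributions n" and f: "f \<in> bool_funs n" and "n \<ge> 1" "0 < \<epsilon>" "\<epsilon> < 1"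
    and far: "dist_class D f (small_class n) > \<epsilon>"
  shows "real (card {i\<in>{1..n}. f i}) > real (n div 5) + \<epsilon> * real n / 10"
proof -
  let ?k = "card {i\<in>{1..n}. f i}"
  have big: "real ?k > real n / 5"
  proof (rule ccontr)
    assume "\<not> ?thesis"
    hence "f \<in> small_class n" using f by (simp add: small_class_def)
    from dist_class_le[OF this, of D f] far assms(4) show False by (simp add: dist_fun_def)
  qed
  have k: "n div 5 < ?k" using big by linarith
  have "\<epsilon> * real ?k \<le> dist_class D f (small_class n) * real ?k"
    using far by (intro mult_right_mono) auto
  also have "\<dots> \<le> real (?k - n div 5)"
    using dist_class_small_class_le[OF D f big] by (simp add: mult.commute)
  also have "\<dots> = real ?k - real (n div 5)" using k by (simp add: of_nat_diff)
  finally have 1: "\<epsilon> * real ?k \<le> real ?k - real (n div 5)" .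
  have "\<epsilon> * (real n / 10) < \<epsilon> * real ?k"
    using big assms by (intro mult_strict_left_mono) auto
  with 1 show ?thesis by simp
qed

lemma small_class_tester:
  assumes "n \<ge> 2" "0 < \<epsilon>" "\<epsilon> < 1"
  shows "\<exists>T q. df_tester n \<epsilon> (small_class n) q T \<and> nonadaptive n T \<and> real q \<le> 401 / \<epsilon>\<^sup>2"
proof -
  \<comment> \<open>The threshold \<open>t\<close> lies midway between the densities
    \<open>n div 5 / n\<close> and \<open>n div 5 / n + \<epsilon>/10\<close> that have to be
    separated. With deviation \<epsilon>/20 the Hoeffding exponent
    \<open>2 * N * (\<epsilon>/20)^2\<close> is at least 2, and \<open>exp (-2)\<close> is at most
    1/3. Rounding up \<open>N\<close> costs at most 1, which is at most
    \<open>1 / \<epsilon>^2\<close>.\<close>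
  define N where "N = nat \<lceil>400 / \<epsilon>\<^sup>2\<rceil>"
  define t where "t = real N * (real (n div 5) / real n + \<epsilon> / 20)"
  define T where "T = poll_tester n N t"
  have N400: "real N \<ge> 400 / \<epsilon>\<^sup>2" unfolding N_def by linarith
  have "1 \<le> 1 / \<epsilon>\<^sup>2" using assms by (simp add: power_le_one)
  hence N401: "real N \<le> 401 / \<epsilon>\<^sup>2" unfolding N_def by (simp add: field_simps) linarith
  have Npos: "N > 0" using N400 \<open>1 \<le> 1 / \<epsilon>\<^sup>2\<close> by (cases N) auto
  have "exp (- 2 * real N * (\<epsilon> / 20)\<^sup>2) \<le> exp (-2)"
    using N400 assms by (simp add: field_simps power2_eq_square)
  also have "exp (-2::real) \<le> 1/3"
    using exp_ge_add_one_self[of "2::real"] by (simp add: exp_minus field_simps)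
  finally have tail: "exp (- 2 * real N * (\<epsilon> / 20)\<^sup>2) \<le> 1/3" .
  have main: "(f \<in> small_class n \<longrightarrow> accept_prob T D f \<ge> 2/3) \<and>
        (dist_class D f (small_class n) > \<epsilon> \<longrightarrow> reject_prob T D f \<ge> 2/3)"
    if D: "D \<in> distributions n" and f: "f \<in> bool_funs n" for D f
  proof -
    define k where "k = card {i\<in>{1..n}. f i}"
    define p where "p = real k / real n"
    have "k \<le> card {1..n}" unfolding k_def by (intro card_mono) auto
    then interpret binomial_distribution N p
      by unfold_locales (use assms in \<open>auto simp: p_def divide_le_eq_1\<close>)
    have V: "verdict_pmf T D f = map_pmf (\<lambda>c. real c \<le> t) (binomial_pmf N p)"
      unfolding T_def p_def k_def using assms by (intro verdict_poll_tester) auto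
    let ?P = "measure_pmf.prob (binomial_pmf N p)"
    have acc: "accept_prob T D f = ?P {c. real c \<le> t}"
      by (simp add: accept_prob_def V pmf_map vimage_def)
    have rej: "reject_prob T D f = ?P {c. \<not> real c \<le> t}"
      by (simp add: reject_prob_def V pmf_map vimage_def)
    have compl: "?P {c. real c \<le> t} + ?P {c. \<not> real c \<le> t} = 1"
      using measure_pmf.prob_compl[of "{c. real c \<le> t}" "binomial_pmf N p"]
      by (simp add: Compl_eq_Diff_UNIV[symmetric] Collect_neg_eq)
    have "accept_prob T D f \<ge> 2/3" if "f \<in> small_class n"
    proof -
      have "real k \<le> real n / 5" using that by (simp add: small_class_def k_def)
      \<comment> \<open>Integrality sharpens \<open>n/5\<close> to \<open>n div 5\<close>, the level
        from which \<open>t\<close> is measured.\<close>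
      hence "k \<le> n div 5" by linarith
      hence "p \<le> real (n div 5) / real n" by (simp add: p_def divide_right_mono)
      hence "real N * (p + \<epsilon> / 20) \<le> t" unfolding t_def by (intro mult_left_mono) auto
      hence "?P {c. \<not> real c \<le> t} \<le> ?P {c. real c / real N \<ge> p + \<epsilon> / 20}"
        using Npos
        by (intro measure_pmf.finite_measure_mono) (auto simp: pos_le_divide_eq mult.commute)
      also have "\<dots> \<le> 1/3"
        using prob_ge'[of "\<epsilon> / 20"] Npos assms tail by simp
      finally show ?thesis using acc compl by simp
    qed
    moreover have "reject_prob T D f \<ge> 2/3" if "dist_class D f (small_class n) > \<epsilon>"
    proof -
      have "real k > real (n div 5) + \<epsilon> * real n / 10"
        unfolding k_def using far_density_gap[OF D f] that assms by simp
      hence "p \<ge> (real (n div 5) + \<epsilon> * real n / 10) / real n"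
        unfolding p_def by (intro divide_right_mono) auto
      also have "(real (n div 5) + \<epsilon> * real n / 10) / real n = real (n div 5) / real n + \<epsilon> / 10"
        using assms by (simp add: add_divide_distrib)
      finally have "p - \<epsilon> / 20 \<ge> real (n div 5) / real n + \<epsilon> / 20" by simp
      hence "t \<le> real N * (p - \<epsilon> / 20)" unfolding t_def by (intro mult_left_mono) auto
      hence "?P {c. real c \<le> t} \<le> ?P {c. real c / real N \<le> p - \<epsilon> / 20}"
        using Npos
        by (intro measure_pmf.finite_measure_mono) (auto simp: pos_divide_le_eq mult.commute)
      also have "\<dots> \<le> 1/3"
        using prob_le'[of "\<epsilon> / 20"] Npos assms tail by simp
      finally show ?thesis using rej compl by simp
    qed
    ultimately show ?thesis by blast
  qed
  have "query_algorithm n N T"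
    unfolding query_algorithm_def
  proof safe
    fix A rs assume A: "A \<in> set_pmf T" "rs \<in> traces n A"
    from assms poll_tester_requests[of n A N t] A(1) obtain xs where
      xs: "set xs \<subseteq> {1..n}" "length xs = N" "traces n A \<subseteq> {map Query_Request xs}"
      unfolding T_def by auto
    have rs: "rs = map Query_Request xs" using xs(3) A(2) by blast
    show "length rs \<le> N" using xs(2) rs by simp
    fix x assume "Query_Request x \<in> set rs"
    hence "x \<in> set xs" using rs by auto
    thus "x \<in> {1..n}" using xs(1) by blast
  qed
  moreover have "nonadaptive n T"
    unfolding nonadaptive_def
  proof
    fix A assume A: "A \<in> set_pmf T"
    from assms poll_tester_requests[of n A N t] A obtain xs where
      "traces n A \<subseteq> {map Query_Request xs}"
      unfolding T_def by auto
    thus "\<exists>rs. \<forall>rs'\<in>traces n A. rs' = rs" by auto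
  qed
  ultimately show ?thesis using main N401 unfolding df_tester_def by blast
qed

subsection \<open>Acceptance probabilities as polynomials\<close>

text \<open>
  The acceptance probability as a polynomial expression in the masses \<open>\<mu>\<close>, which here may be
  arbitrary reals.
\<close>

primrec formal_accept :: "nat \<Rightarrow> (nat \<Rightarrow> bool) \<Rightarrow> (nat \<Rightarrow> real) \<Rightarrow> algorithm \<Rightarrow> real" where
  "formal_accept n f \<mu> (Verdict b) = of_bool b"
| "formal_accept n f \<mu> (Query x k) = formal_accept n f \<mu> (k (f x))"
| "formal_accept n f \<mu> (Sample k) = (\<Sum>x\<in>{1..n}. \<mu> x * formal_accept n f \<mu> (k x (f x)))"

lemma pmf_exec_eq_formal_accept:
  assumes "D \<in> distributions n"
  shows "pmf (map_pmf snd (exec D f A)) True = formal_accept n f (pmf D) A"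
proof (induction A)
  case (Query x k)
  thus ?case by (simp add: pmf.map_comp o_def)
next
  case (Sample k)
  have "pmf (map_pmf snd (exec D f (Sample k))) True
      = measure_pmf.expectation D (\<lambda>x. pmf (map_pmf snd (exec D f (k x (f x)))) True)"
    by (simp add: map_bind_pmf pmf.map_comp o_def pmf_bind)
  also have "\<dots> = (\<Sum>x\<in>{1..n}. pmf (map_pmf snd (exec D f (k x (f x)))) True * pmf D x)"
    using assms by (intro integral_measure_pmf_real) (auto simp: distributions_def)
  finally show ?case using Sample[OF rangeI rangeI] by (simp add: mult.commute)
qed simp

section \<open>Decision trees of bounded depth\<close>

text \<open>Counterpart of the bound on traces that mentions no distribution: queries are answered
  by the fixed \<open>f\<close>, samples branch over all of \<open>{1..n}\<close>. This suits
  induction on the tree.\<close>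

primrec depth_le :: "nat \<Rightarrow> (nat \<Rightarrow> bool) \<Rightarrow> algorithm \<Rightarrow> nat \<Rightarrow> bool" where
  "depth_le n f (Verdict b) = (\<lambda>q. True)"
| "depth_le n f (Query x k) = (\<lambda>q. \<exists>r. q = Suc r \<and> depth_le n f (k (f x)) r)"
| "depth_le n f (Sample k) = (\<lambda>q. \<exists>r. q = Suc r \<and> (\<forall>x\<in>{1..n}. depth_le n f (k x (f x)) r))"

text \<open>Under full support every branch over sample points has positive probability, so its
  requests occur in the support of \<open>exec\<close>.\<close>

lemma depth_le_if_exec:
  assumes "set_pmf D = {1..n}" "\<And>rb. rb \<in> set_pmf (exec D f A) \<Longrightarrow> length (fst rb) \<le> q"
  shows "depth_le n f A q"
  using assms(2)
proof (induction A arbitrary: q)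
  case (Query x k)
  have prem: "Suc (length a) \<le> q" if "(a, b) \<in> set_pmf (exec D f (k (f x)))" for a b
    using Query.prems[of "(Query_Request x # a, b)"] that by force
  obtain a b where "(a, b) \<in> set_pmf (exec D f (k (f x)))"
    using set_pmf_not_empty[of "exec D f (k (f x))"] by auto
  hence "1 \<le> q" using prem by force
  then obtain r where r: "q = Suc r" by (cases q) auto
  have "depth_le n f (k (f x)) r"
  proof (rule Query.IH)
    fix rb assume "rb \<in> set_pmf (exec D f (k (f x)))"
    thus "length (fst rb) \<le> r"
      using prem[of "fst rb" "snd rb"] r by simp
  qed simp
  thus ?case using r by simp
next
  case (Sample k)
  have prem: "Suc (length a) \<le> q" if "x \<in> set_pmf D" "(a, b) \<in> set_pmf (exec D f (k x (f x)))" for x a b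
    using Sample.prems[of "(Sample_Request # a, b)"] that by force
  obtain x where x: "x \<in> set_pmf D" using set_pmf_not_empty by fast
  obtain a b where "(a, b) \<in> set_pmf (exec D f (k x (f x)))"
    using set_pmf_not_empty[of "exec D f (k x (f x))"] by auto
  hence "1 \<le> q" using prem x by force
  then obtain r where r: "q = Suc r" by (cases q) auto
  have "depth_le n f (k x (f x)) r" if "x \<in> {1..n}" for x
  proof (rule Sample.IH)
    fix rb assume "rb \<in> set_pmf (exec D f (k x (f x)))"
    thus "length (fst rb) \<le> r"
      using prem[of x "fst rb" "snd rb"] r that assms(1) by simp
  qed auto
  thus ?case using r by simp
qed simp

lemma depth_le_query_algorithm:
  assumes "query_algorithm n q T" "A \<in> set_pmf T" "f \<in> bool_funs n" "n \<ge> 1"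
  shows "depth_le n f A q"
proof (rule depth_le_if_exec)
  let ?U = "pmf_of_set {1..n}"
  show U: "set_pmf ?U = {1..n}" using assms(4) by simp
  fix rb assume "rb \<in> set_pmf (exec ?U f A)"
  hence "fst rb \<in> traces n A"
    unfolding traces_def using assms(3) U by (intro UN_I[of ?U] UN_I[of f]) (auto simp: distributions_def)
  thus "length (fst rb) \<le> q" using assms(1,2) by (auto simp: query_algorithm_def)
qed

text \<open>The coefficients are dominated by those of (1 + 2v)^q. The points \<open>i\<close> and
  \<open>d\<close> share the mass \<open>r\<close>. A sample averages the subtree polynomials with
  the weights \<open>base x\<close> and \<open>r\<close>, which sum to 1, and adds v (P i - P d).
  Averaging keeps the bound, the second part adds twice the bound for the preceding coefficient, and
  Pascal's rule closes the induction.\<close>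

lemma formal_accept_poly:
  fixes \<mu> :: "real \<Rightarrow> nat \<Rightarrow> real"
  assumes A: "depth_le n f A q"
    and i: "i \<in> {1..n}" "d \<in> {1..n}" "i \<noteq> d"
    and \<mu>: "\<And>v. \<mu> v i = v" "\<And>v. \<mu> v d = r - v"
      "\<And>v x. x \<in> {1..n} - {i, d} \<Longrightarrow> \<mu> v x = base x"
    and base: "\<And>x. x \<in> {1..n} - {i, d} \<Longrightarrow> base x \<ge> 0"
      "(\<Sum>x\<in>{1..n} - {i, d}. base x) = 1 - r" "r \<ge> 0"
  shows "\<exists>P. (\<forall>v. formal_accept n f (\<mu> v) A = poly P v) \<and>
             (\<forall>k. \<bar>coeff P k\<bar> \<le> 2 ^ k * real (q choose k))"
  using A
proof (induction A arbitrary: q)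
  case (Verdict b)
  show ?case
    by (rule exI[of _ "[:of_bool b:]"]) (auto simp: coeff_pCons split: nat.split)
next
  case (Query x k)
  then obtain p where p: "q = Suc p" "depth_le n f (k (f x)) p" by auto
  from Query.IH[OF _ p(2)] obtain P where
    P: "\<And>v. formal_accept n f (\<mu> v) (k (f x)) = poly P v"
       "\<And>j. \<bar>coeff P j\<bar> \<le> 2 ^ j * real (p choose j)" by auto
  have "\<bar>coeff P j\<bar> \<le> 2 ^ j * real (q choose j)" for j
    by (rule order_trans[OF P(2)]) (cases j; simp add: p(1))
  thus ?case using P(1) by auto
next
  case (Sample k)
  then obtain p where p: "q = Suc p" "\<And>x. x \<in> {1..n} \<Longrightarrow> depth_le n f (k x (f x)) p" by auto
  have "\<exists>P. (\<forall>v. formal_accept n f (\<mu> v) (k x (f x)) = poly P v) \<and>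
             (\<forall>j. \<bar>coeff P j\<bar> \<le> 2 ^ j * real (p choose j))" if "x \<in> {1..n}" for x
    by (rule Sample.IH[OF rangeI rangeI p(2)[OF that]])
  hence "\<exists>P. \<forall>x\<in>{1..n}. (\<forall>v. formal_accept n f (\<mu> v) (k x (f x)) = poly (P x) v) \<and>
             (\<forall>j. \<bar>coeff (P x) j\<bar> \<le> 2 ^ j * real (p choose j))"
    by (intro bchoice) blast
  then obtain P where
    P: "\<And>x v. x \<in> {1..n} \<Longrightarrow> formal_accept n f (\<mu> v) (k x (f x)) = poly (P x) v"
       "\<And>x j. x \<in> {1..n} \<Longrightarrow> \<bar>coeff (P x) j\<bar> \<le> 2 ^ j * real (p choose j)" by blast
  let ?O = "{1..n} - {i, d}"
  define Q where "Q = (\<Sum>x\<in>?O. smult (base x) (P x)) + pCons 0 (P i - P d) + smult r (P d)"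
  have split: "{1..n} = insert i (insert d ?O)" using i by auto
  have eval: "formal_accept n f (\<mu> v) (Sample k) = poly Q v" for v
  proof -
    have "formal_accept n f (\<mu> v) (Sample k) = (\<Sum>x\<in>{1..n}. \<mu> v x * poly (P x) v)"
      using P(1) by simp
    also have "\<dots> = \<mu> v i * poly (P i) v + (\<mu> v d * poly (P d) v + (\<Sum>x\<in>?O. \<mu> v x * poly (P x) v))"
      using i(3) by (subst split) (simp only: sum.insert finite_insert finite_Diff finite_atLeastAtMost
          insert_iff Diff_iff simp_thms singleton_iff if_False)
    also have "(\<Sum>x\<in>?O. \<mu> v x * poly (P x) v) = (\<Sum>x\<in>?O. base x * poly (P x) v)"
      by (intro sum.cong) (auto simp: \<mu>(3))
    finally show ?thesis by (simp add: Q_def poly_sum \<mu>(1,2) algebra_simps)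
  qed
  have coef: "\<bar>coeff Q j\<bar> \<le> 2 ^ j * real (q choose j)" for j
  proof -
    let ?c = "2 ^ j * real (p choose j)"
    have "\<bar>\<Sum>x\<in>?O. base x * coeff (P x) j\<bar> \<le> (\<Sum>x\<in>?O. base x * ?c)"
      by (rule order_trans[OF sum_abs])
         (intro sum_mono, auto simp: abs_mult base(1) intro!: mult_left_mono P(2))
    also have "\<dots> = (1 - r) * ?c" by (simp only: base(2) flip: sum_distrib_right)
    finally have 1: "\<bar>\<Sum>x\<in>?O. base x * coeff (P x) j\<bar> \<le> (1 - r) * ?c" .
    have 2: "\<bar>r * coeff (P d) j\<bar> \<le> r * ?c"
      using base(3) P(2)[OF i(2)] by (simp add: abs_mult mult_left_mono)
    have cQ: "coeff Q j = (\<Sum>x\<in>?O. base x * coeff (P x) j) + coeff (pCons 0 (P i - P d)) j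
        + r * coeff (P d) j"
      by (simp add: Q_def coeff_sum)
    show ?thesis
    proof (cases j)
      case 0
      thus ?thesis using 1 2 unfolding cQ by (simp add: algebra_simps)
    next
      case (Suc l)
      have "\<bar>coeff (pCons 0 (P i - P d)) j\<bar> \<le> 2 ^ j * real (p choose l)"
        using P(2)[OF i(1), of l] P(2)[OF i(2), of l] by (simp add: Suc)
      moreover have "2 ^ j * real (q choose j) = ?c + 2 ^ j * real (p choose l)"
        by (simp add: Suc p(1) algebra_simps)
      ultimately show ?thesis using 1 2 unfolding cQ by (simp add: algebra_simps)
    qed
  qed
  show ?case using eval coef by blast
qed

section \<open>Polynomials under matching moments\<close>

text \<open>Chernoff's trick: inflating the k-th term by \<open>exp (2 * (k - M))\<close>, which is
  at least 1 here, allows the sum to be completed to a full binomial expansion, at most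
  \<open>exp (q * y * exp 2 - 2 * M)\<close>.\<close>

lemma binomial_tail_le_exp:
  fixes y :: real
  assumes "0 \<le> y" "real q * y * exp 2 \<le> real M"
  shows "(\<Sum>k\<in>{M..q}. real (q choose k) * y ^ k) \<le> exp (- real M)"
proof -
  have "(\<Sum>k\<in>{M..q}. real (q choose k) * y ^ k)
      \<le> (\<Sum>k\<in>{M..q}. exp (- 2 * real M) * (real (q choose k) * (y * exp 2) ^ k))"
  proof (intro sum_mono)
    fix k assume "k \<in> {M..q}"
    hence "1 \<le> exp (2 * (real k - real M))" by simp
    also have "\<dots> = exp (- 2 * real M) * exp 2 ^ k"
      by (simp add: exp_of_nat_mult[symmetric] exp_add[symmetric] algebra_simps)
    finally have "real (q choose k) * y ^ k * 1
        \<le> real (q choose k) * y ^ k * (exp (- 2 * real M) * exp 2 ^ k)"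
      using assms(1) by (intro mult_left_mono) auto
    thus "real (q choose k) * y ^ k \<le> exp (- 2 * real M) * (real (q choose k) * (y * exp 2) ^ k)"
      by (simp add: power_mult_distrib algebra_simps)
  qed
  also have "\<dots> \<le> (\<Sum>k\<le>q. exp (- 2 * real M) * (real (q choose k) * (y * exp 2) ^ k))"
    using assms(1) by (intro sum_mono2) auto
  also have "\<dots> = exp (- 2 * real M) * (y * exp 2 + 1) ^ q"
    by (simp add: binomial_ring sum_distrib_left)
  also have "\<dots> \<le> exp (- 2 * real M) * exp (y * exp 2) ^ q"
    using assms(1) exp_ge_add_one_self[of "y * exp 2"]
    by (intro mult_left_mono power_mono) (auto simp: add.commute)
  also have "\<dots> = exp (real q * y * exp 2 - 2 * real M)"
    by (simp add: exp_of_nat_mult[symmetric] exp_add[symmetric] algebra_simps)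
  also have "\<dots> \<le> exp (- real M)" using assms(2) by simp
  finally show ?thesis .
qed

text \<open>Only moments of order at least \<open>M\<close> can differ, and both lie in
  \<open>{0..u^k}\<close>. With the coefficient bound the difference is a binomial tail at
  \<open>y = 2 * u\<close>.\<close>

lemma expectation_poly_close:
  fixes A B :: "real pmf"
  assumes fin: "finite (set_pmf A)" "finite (set_pmf B)"
    and supp: "set_pmf A \<subseteq> {0..u}" "set_pmf B \<subseteq> {0..u}"
    and moments: "\<And>k. k < M \<Longrightarrow>
      measure_pmf.expectation A (\<lambda>y. y ^ k) = measure_pmf.expectation B (\<lambda>y. y ^ k)"
    and P: "\<And>k. \<bar>coeff P k\<bar> \<le> 2 ^ k * real (q choose k)"
    and small: "real q * (2 * u) * exp 2 \<le> real M" and "0 \<le> u"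
  shows "\<bar>measure_pmf.expectation A (poly P) - measure_pmf.expectation B (poly P)\<bar> \<le> exp (- real M)"
proof -
  have deg: "degree P \<le> q"
  proof (rule degree_le, intro allI impI)
    fix k assume "q < k"
    thus "coeff P k = 0" using P[of k] by (simp add: binomial_eq_0)
  qed
  have poly: "poly P y = (\<Sum>k\<le>q. coeff P k * y ^ k)" for y
    unfolding poly_altdef using deg by (intro sum.mono_neutral_left) (auto intro: coeff_eq_0)
  have exp_poly: "measure_pmf.expectation C (poly P)
      = (\<Sum>k\<le>q. coeff P k * measure_pmf.expectation C (\<lambda>y. y ^ k))"
    if "finite (set_pmf C)" for C :: "real pmf"
    unfolding poly
    by (subst Bochner_Integration.integral_sum) (auto intro: integrable_measure_pmf_finite that)
  have range: "measure_pmf.expectation C (\<lambda>y. y ^ k) \<in> {0..u ^ k}"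
    if "finite (set_pmf C)" "set_pmf C \<subseteq> {0..u}" for C :: "real pmf" and k
  proof -
    have "measure_pmf.expectation C (\<lambda>y. y ^ k) \<le> measure_pmf.expectation C (\<lambda>y. u ^ k)"
      using that by (intro integral_mono_AE integrable_measure_pmf_finite)
        (auto simp: AE_measure_pmf_iff intro!: power_mono)
    moreover have "0 \<le> measure_pmf.expectation C (\<lambda>y. y ^ k)"
      using that by (intro integral_nonneg_AE) (auto simp: AE_measure_pmf_iff)
    ultimately show ?thesis by simp
  qed
  let ?\<Delta> = "\<lambda>k. measure_pmf.expectation A (\<lambda>y. y ^ k) - measure_pmf.expectation B (\<lambda>y. y ^ k)"
  have "measure_pmf.expectation A (poly P) - measure_pmf.expectation B (poly P)
      = (\<Sum>k\<le>q. coeff P k * ?\<Delta> k)"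
    by (simp add: exp_poly fin algebra_simps sum_subtractf)
  also have "\<dots> = (\<Sum>k\<in>{M..q}. coeff P k * ?\<Delta> k)"
    using moments by (intro sum.mono_neutral_right) auto
  also have "\<bar>\<dots>\<bar> \<le> (\<Sum>k\<in>{M..q}. real (q choose k) * (2 * u) ^ k)"
  proof (rule order_trans[OF sum_abs], rule sum_mono)
    fix k
    have "\<bar>?\<Delta> k\<bar> \<le> u ^ k" using range[OF fin(1) supp(1), of k] range[OF fin(2) supp(2), of k] by auto
    hence "\<bar>coeff P k\<bar> * \<bar>?\<Delta> k\<bar> \<le> (2 ^ k * real (q choose k)) * u ^ k"
      by (intro mult_mono P) auto
    thus "\<bar>coeff P k * ?\<Delta> k\<bar> \<le> real (q choose k) * (2 * u) ^ k"
      by (simp add: abs_mult power_mult_distrib mult_ac)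
  qed
  also have "\<dots> \<le> exp (- real M)"
    using assms by (intro binomial_tail_le_exp) auto
  finally show ?thesis .
qed

section \<open>Concentration and hybrids\<close>

text \<open>Markov's inequality for the exponential of the sum, whose expectation factors by
  independence. It serves both for the total mass and, with a negative \<open>g\<close>, for the
  number of zeros.\<close>

lemma Pi_pmf_sum_tail:
  fixes g :: "'b \<Rightarrow> real"
  assumes "finite I" "\<And>i. i \<in> I \<Longrightarrow> finite (set_pmf (P i))"
    and mgf: "\<And>i. i \<in> I \<Longrightarrow> measure_pmf.expectation (P i) (\<lambda>v. exp (g v)) \<le> exp c"
  shows "measure_pmf.prob (Pi_pmf I d P) {h. t \<le> (\<Sum>i\<in>I. g (h i))} \<le> exp (real (card I) * c - t)"
proof -
  let ?H = "Pi_pmf I d P"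
  have int: "integrable (measure_pmf ?H) (\<lambda>h. \<Prod>i\<in>I. exp (g (h i)))"
    using assms by (intro integrable_prod_Pi_pmf integrable_measure_pmf_finite) auto
  have "measure_pmf.prob ?H {h. t \<le> (\<Sum>i\<in>I. g (h i))}
      = measure_pmf.prob ?H {h. exp t \<le> (\<Prod>i\<in>I. exp (g (h i)))}"
    using assms(1) by (simp flip: exp_sum)
  also have "\<dots> \<le> measure_pmf.expectation ?H (\<lambda>h. \<Prod>i\<in>I. exp (g (h i))) / exp t"
    using integral_Markov_inequality_measure[OF int, of "{}" "exp t"] by (simp add: prod_nonneg)
  also have "measure_pmf.expectation ?H (\<lambda>h. \<Prod>i\<in>I. exp (g (h i)))
      = (\<Prod>i\<in>I. measure_pmf.expectation (P i) (\<lambda>v. exp (g v)))"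
    using assms by (intro expectation_prod_Pi_pmf integrable_measure_pmf_finite) auto
  also have "\<dots> \<le> (\<Prod>i\<in>I. exp c)"
    using mgf by (intro prod_mono) (auto intro!: integral_nonneg_AE)
  also have "\<dots> = exp (real (card I) * c)" by (simp add: exp_of_nat_mult)
  finally show ?thesis by (simp add: exp_diff divide_right_mono)
qed

text \<open>On [0,1] the exponential is at most 1 + z + z^2 and hence at most 1 + 2z, so the mean
  alone controls the exponential moment.\<close>

lemma expectation_exp_scaled_le:
  fixes C :: "real pmf"
  assumes "finite (set_pmf C)" "set_pmf C \<subseteq> {0..u}" "0 < u"
    and mean: "measure_pmf.expectation C (\<lambda>y. y) \<le> m"
  shows "measure_pmf.expectation C (\<lambda>y. exp (y / u)) \<le> exp (2 * m / u)"
proof -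
  have "measure_pmf.expectation C (\<lambda>y. exp (y / u)) \<le> measure_pmf.expectation C (\<lambda>y. 1 + 2 / u * y)"
  proof (intro integral_mono_AE integrable_measure_pmf_finite assms(1))
    have "exp (y / u) \<le> 1 + 2 / u * y" if "y \<in> {0..u}" for y
    proof -
      have yu: "0 \<le> y / u" "y / u \<le> 1" using that assms(3) by auto
      have "exp (y / u) \<le> 1 + y / u + (y / u)\<^sup>2" using yu by (rule exp_bound)
      also have "(y / u)\<^sup>2 \<le> y / u"
        using power_decreasing[of 1 2 "y / u"] yu by simp
      finally show ?thesis by simp
    qed
    thus "AE y in measure_pmf C. exp (y / u) \<le> 1 + 2 / u * y"
      using assms(2) by (auto simp: AE_measure_pmf_iff)
  qed
  also have "\<dots> = 1 + 2 / u * measure_pmf.expectation C (\<lambda>y. y)"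
    by (subst Bochner_Integration.integral_add)
       (auto intro: integrable_measure_pmf_finite assms(1))
  also have "\<dots> \<le> 1 + 2 / u * m" using mean assms(3) by (intro add_left_mono mult_left_mono) auto
  also have "\<dots> \<le> exp (2 * m / u)" using exp_ge_add_one_self[of "2 * m / u"] by simp
  finally show ?thesis .
qed

text \<open>Since \<open>exp (-1)\<close> is at most 1/2, the expectation is at most
  \<open>1 - pmf C 0 / 2\<close>.\<close>

lemma expectation_exp_minus_zero_le:
  fixes C :: "real pmf"
  assumes "pmf C 0 \<ge> a" "0 \<le> a"
  shows "measure_pmf.expectation C (\<lambda>y. exp (- of_bool (y = 0))) \<le> exp (- a / 2)"
proof -
  have half: "exp (- 1 :: real) \<le> 1 / 2"
    using exp_ge_add_one_self[of "1::real"] by (simp add: exp_minus field_simps)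
  have "measure_pmf.expectation C (\<lambda>y. exp (- of_bool (y = 0)))
      \<le> measure_pmf.expectation C (\<lambda>y. 1 - 1 / 2 * indicator {0} y :: real)"
    using half by (intro integral_mono_AE measure_pmf.integrable_const_bound[where B = 1])
      (auto simp: indicator_def)
  also have "\<dots> = 1 - pmf C 0 / 2"
    by (subst Bochner_Integration.integral_diff)
       (auto simp: measure_pmf_single intro!: measure_pmf.integrable_const_bound[where B = 1]
          split: split_indicator)
  also have "\<dots> \<le> 1 - a / 2" using assms by simp
  also have "\<dots> \<le> exp (- a / 2)" using exp_ge_add_one_self[of "- a / 2"] by simp
  finally show ?thesis .
qed

text \<open>Coordinates switch from \<open>A\<close> to \<open>B\<close> one at a time and the
  differences telescope; \<open>step\<close> has to cover arbitrary mixtures because the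
  intermediate families are such.\<close>

lemma hybrid_argument:
  fixes F :: "('i \<Rightarrow> 'c) \<Rightarrow> real"
  assumes "finite I"
    and step: "\<And>P i. i \<in> I \<Longrightarrow> (\<And>j. P j \<in> {A, B}) \<Longrightarrow> \<bar>F (P(i := A)) - F (P(i := B))\<bar> \<le> \<delta>"
  shows "\<bar>F (\<lambda>_. A) - F (\<lambda>j. if j \<in> I then B else A)\<bar> \<le> real (card I) * \<delta>"
proof -
  have "\<bar>F (\<lambda>_. A) - F (\<lambda>j. if j \<in> J then B else A)\<bar> \<le> real (card J) * \<delta>" if "J \<subseteq> I" for J
    using finite_subset[OF that assms(1)] that
  proof (induction J)
    case (insert i J)
    let ?P = "\<lambda>j. if j \<in> J then B else A"
    have "?P(i := A) = ?P" "?P(i := B) = (\<lambda>j. if j \<in> insert i J then B else A)"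
      using insert by auto
    hence "\<bar>F ?P - F (\<lambda>j. if j \<in> insert i J then B else A)\<bar> \<le> \<delta>"
      using step[of i ?P] insert by simp
    thus ?case using insert by (auto simp: algebra_simps)
  qed simp
  thus ?thesis by blast
qed

subsection \<open>Lower bound for tolerant testers\<close>

definition hard_mass :: "nat \<Rightarrow> (nat \<Rightarrow> real) \<Rightarrow> nat \<Rightarrow> real" where
  "hard_mass N V x =
     (if x \<in> {1..N} then V x else if x = Suc N then 1 - (\<Sum>i\<in>{1..N}. V i) else 0)"

text \<open>The fallback value only makes the definition total; it is hit with negligible probability.\<close>

definition hard_dist :: "nat \<Rightarrow> (nat \<Rightarrow> real) \<Rightarrow> nat pmf" where
  "hard_dist N V =
     (if (\<forall>i\<in>{1..N}. 0 \<le> V i) \<and> (\<Sum>i\<in>{1..N}. V i) \<le> 1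
      then SOME p. \<forall>x. pmf p x = hard_mass N V x else return_pmf (Suc N))"

lemma pmf_hard_dist:
  assumes "\<And>i. i \<in> {1..N} \<Longrightarrow> 0 \<le> V i" "(\<Sum>i\<in>{1..N}. V i) \<le> 1"
  shows "pmf (hard_dist N V) x = hard_mass N V x"
proof -
  have "(\<Sum>x\<in>{1..Suc N}. hard_mass N V x) = (\<Sum>x\<in>{1..N}. hard_mass N V x) + hard_mass N V (Suc N)"
    by simp
  also have "(\<Sum>x\<in>{1..N}. hard_mass N V x) = (\<Sum>x\<in>{1..N}. V x)"
    by (intro sum.cong) (auto simp: hard_mass_def)
  finally have total: "(\<Sum>x\<in>{1..Suc N}. hard_mass N V x) = 1" by (simp add: hard_mass_def)
  have nonneg: "0 \<le> hard_mass N V x" for x using assms by (auto simp: hard_mass_def)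
  obtain p where p: "\<And>x. pmf p x = (if x \<in> {1..Suc N} then hard_mass N V x else 0)"
    using ex_pmf_weights[OF finite_atLeastAtMost nonneg total] by blast
  hence "\<exists>p. \<forall>x. pmf p x = hard_mass N V x"
    by (intro exI[of _ p]) (auto simp: p hard_mass_def)
  from someI_ex[OF this] show ?thesis using assms by (auto simp: hard_dist_def)
qed

lemma set_hard_dist: "set_pmf (hard_dist N V) \<subseteq> {i\<in>{1..N}. V i \<noteq> 0} \<union> {Suc N}"
proof (cases "(\<forall>i\<in>{1..N}. 0 \<le> V i) \<and> (\<Sum>i\<in>{1..N}. V i) \<le> 1")
  case True
  thus ?thesis using pmf_hard_dist[of N V]
    by (auto simp: set_pmf_iff hard_mass_def split: if_splits)
next
  case False
  hence "hard_dist N V = return_pmf (Suc N)" unfolding hard_dist_def by (rule if_not_P)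
  thus ?thesis by simp
qed

lemma hard_dist_in_distributions: "Suc N \<le> n \<Longrightarrow> hard_dist N V \<in> distributions n"
  using set_hard_dist[of N V] by (fastforce simp: distributions_def)

lemma card_filter_split:
  "finite S \<Longrightarrow> card S = card {x\<in>S. P x} + card {x\<in>S. \<not> P x}"
  by (subst card_Un_disjoint[symmetric]) (auto intro: arg_cong[where f = card])

lemma all_false_in_small_class: "(\<lambda>x\<in>{1..n}. False) \<in> small_class n"
proof -
  have "{i\<in>{1..n}. (\<lambda>x\<in>{1..n}. False) i} = {}" by auto
  hence "card {i\<in>{1..n}. (\<lambda>x\<in>{1..n}. False) i} = 0" by (simp only: card.empty)
  hence "real (card {i\<in>{1..n}. (\<lambda>x\<in>{1..n}. False) i}) \<le> real n / 5" by linarith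
  moreover have "(\<lambda>x\<in>{1..n}. False) \<in> bool_funs n" by (simp add: bool_funs_def)
  ultimately show ?thesis unfolding small_class_def by blast
qed

definition all_ones :: "nat \<Rightarrow> nat \<Rightarrow> bool" where
  "all_ones n = (\<lambda>x\<in>{1..n}. True)"

lemma all_ones_in_bool_funs: "all_ones n \<in> bool_funs n"
  by (auto simp: all_ones_def bool_funs_def)

text \<open>The indicator of a set containing the support is itself in the class and agrees with
  \<open>all_ones\<close> almost surely. The \<open>+ 1\<close> pays for the point
  \<open>Suc N\<close>.\<close>

lemma dist_class_all_ones_eq_0:
  assumes "Suc N \<le> n" and few: "real (card {i\<in>{1..N}. V i \<noteq> 0}) + 1 \<le> real n / 5"
  shows "dist_class (hard_dist N V) (all_ones n) (small_class n) = 0"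
proof -
  let ?S = "{i\<in>{1..N}. V i \<noteq> 0} \<union> {Suc N}"
  define h where "h = (\<lambda>x\<in>{1..n}. x \<in> ?S)"
  have "{i\<in>{1..n}. h i} = insert (Suc N) {i\<in>{1..N}. V i \<noteq> 0}"
    using assms(1) by (auto simp: h_def)
  hence "card {i\<in>{1..n}. h i} = card {i\<in>{1..N}. V i \<noteq> 0} + 1" by simp
  hence h: "h \<in> small_class n" using few by (auto simp: small_class_def bool_funs_def h_def)
  have "dist_fun (hard_dist N V) (all_ones n) h = 0"
    unfolding dist_fun_def
  proof (subst measure_pmf_zero_iff, intro equals0I)
    fix x assume "x \<in> set_pmf (hard_dist N V) \<inter> {x. all_ones n x \<noteq> h x}"
    thus False using set_hard_dist[of N V] assms(1) by (auto simp: all_ones_def h_def)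
  qed
  hence "dist_class (hard_dist N V) (all_ones n) (small_class n) \<le> 0"
    using dist_class_le[OF h, of "hard_dist N V" "all_ones n"] by simp
  moreover have "0 \<le> dist_class (hard_dist N V) (all_ones n) (small_class n)"
    unfolding dist_class_def using h finite_small_class by (subst Min_ge_iff) (auto simp: dist_fun_def)
  ultimately show ?thesis by simp
qed

text \<open>A member of the class is 1 on at most \<open>n/5\<close> points, hence wrong on at least
  \<open>N - n/5\<close> of the first \<open>N\<close>, each of mass at least
  \<open>w\<close>.\<close>

lemma dist_class_all_ones_ge:
  assumes "Suc N \<le> n" and V: "\<And>i. i \<in> {1..N} \<Longrightarrow> w \<le> V i" "(\<Sum>i\<in>{1..N}. V i) \<le> 1" and "0 \<le> w"
    and "\<epsilon> \<le> (real N - real n / 5) * w"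
  shows "\<epsilon> \<le> dist_class (hard_dist N V) (all_ones n) (small_class n)"
proof -
  have V0: "0 \<le> V i" if "i \<in> {1..N}" for i using V(1)[OF that] assms(4) by simp
  have mass: "pmf (hard_dist N V) i = V i" if "i \<in> {1..N}" for i
    using that by (subst pmf_hard_dist) (auto simp: hard_mass_def V0 intro: V(2)[simplified])
  have far: "\<epsilon> \<le> dist_fun (hard_dist N V) (all_ones n) h" if h: "h \<in> small_class n" for h
  proof -
    let ?Z = "{i\<in>{1..N}. \<not> h i}"
    have "card {1..N} = card {i\<in>{1..N}. h i} + card ?Z" by (rule card_filter_split) simp
    moreover have "card {i\<in>{1..N}. h i} \<le> card {i\<in>{1..n}. h i}"
      using assms(1) by (intro card_mono) auto
    moreover have "real (card {i\<in>{1..n}. h i}) \<le> real n / 5" using h by (simp add: small_class_def)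
    ultimately have Z: "real N - real n / 5 \<le> real (card ?Z)" by simp
    have "\<epsilon> \<le> real (card ?Z) * w"
      using assms(5) mult_right_mono[OF Z assms(4)] by linarith
    also have "\<dots> = (\<Sum>i\<in>?Z. w)" by simp
    also have "\<dots> \<le> (\<Sum>i\<in>?Z. pmf (hard_dist N V) i)"
      by (intro sum_mono) (simp add: mass V(1))
    also have "\<dots> = measure_pmf.prob (hard_dist N V) ?Z"
      by (rule measure_measure_pmf_finite[symmetric]) simp
    also have "\<dots> \<le> dist_fun (hard_dist N V) (all_ones n) h"
      unfolding dist_fun_def using assms(1)
      by (intro measure_pmf.finite_measure_mono) (auto simp: all_ones_def)
    finally show ?thesis .
  qed
  show ?thesis
    unfolding dist_class_def using finite_small_class all_false_in_small_class far
    by (subst Min_ge_iff) auto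
qed

section \<open>Indistinguishability of the two families\<close>

text \<open>With the other masses \<open>h\<close> fixed, each deterministic algorithm accepts with
  a probability polynomial in the mass y of \<open>i\<close>. The bounds 3/4 and 1/4 leave room for
  y, so \<open>hard_dist\<close> never takes its fallback value.\<close>

lemma verdict_hard_dist_close:
  fixes A B :: "real pmf"
  assumes T: "query_algorithm n q T" and f: "f \<in> bool_funs n" and N: "Suc N \<le> n" "i \<in> {1..N}"
    and fin: "finite (set_pmf A)" "finite (set_pmf B)"
    and supp: "set_pmf A \<subseteq> {0..u}" "set_pmf B \<subseteq> {0..u}"
    and moments: "\<And>k. k < M \<Longrightarrow>
      measure_pmf.expectation A (\<lambda>y. y ^ k) = measure_pmf.expectation B (\<lambda>y. y ^ k)"
    and small: "real q * (2 * u) * exp 2 \<le> real M" and u: "0 \<le> u" "u \<le> 1/4"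
    and h: "\<And>j. j \<in> {1..N} - {i} \<Longrightarrow> 0 \<le> h j" "(\<Sum>j\<in>{1..N} - {i}. h j) \<le> 3/4"
  shows "\<bar>pmf (bind_pmf A (\<lambda>y. verdict_pmf T (hard_dist N (h(i := y))) f)) True
        - pmf (bind_pmf B (\<lambda>y. verdict_pmf T (hard_dist N (h(i := y))) f)) True\<bar> \<le> exp (- real M)"
proof -
  let ?D = "\<lambda>y. hard_dist N (h(i := y))"
  define g where "g C alg = pmf (bind_pmf C (\<lambda>y. map_pmf snd (exec (?D y) f alg))) True" for C alg
  \<comment> \<open>The internal randomness of \<open>T\<close> is drawn first, which reduces the
    comparison to deterministic algorithms.\<close>
  have swap: "pmf (bind_pmf C (\<lambda>y. verdict_pmf T (?D y) f)) True = measure_pmf.expectation T (g C)" for C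
    unfolding verdict_pmf_def g_def by (subst bind_commute_pmf) (simp add: pmf_bind)
  let ?s = "\<Sum>j\<in>{1..N} - {i}. h j"
  have sum_upd: "(\<Sum>j\<in>{1..N}. (h(i := y)) j) = y + ?s" for y
    using N(2) by (subst sum.remove[of _ i]) (auto intro!: sum.cong)
  have mass: "pmf (?D y) = hard_mass N (h(i := y))" if "y \<in> {0..u}" for y
  proof (intro ext pmf_hard_dist)
    show "0 \<le> (h(i := y)) j" if "j \<in> {1..N}" for j
      using that h(1) \<open>y \<in> {0..u}\<close> by auto
    show "(\<Sum>j\<in>{1..N}. (h(i := y)) j) \<le> 1"
      unfolding sum_upd using h(2) that u(2) by simp
  qed
  have alg: "\<bar>g A alg - g B alg\<bar> \<le> exp (- real M)" if alg: "alg \<in> set_pmf T" for alg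
  proof -
    define base where "base x = (if x \<in> {1..N} then h x else 0)" for x
    have "\<exists>P. (\<forall>y. formal_accept n f (hard_mass N (h(i := y))) alg = poly P y) \<and>
             (\<forall>k. \<bar>coeff P k\<bar> \<le> 2 ^ k * real (q choose k))"
    \<comment> \<open>The mass \<open>1 - ?s\<close> left by the other points is shared by
      \<open>i\<close> and the extra point.\<close>
    proof (rule formal_accept_poly[where i = i and d = "Suc N" and r = "1 - ?s" and base = base])
      show "depth_le n f alg q" using depth_le_query_algorithm[OF T alg f] N by simp
      have "(\<Sum>x\<in>{1..n} - {i, Suc N}. base x) = (\<Sum>x\<in>{1..N} - {i}. base x)"
        using N by (intro sum.mono_neutral_right) (auto simp: base_def)
      also have "\<dots> = ?s" by (intro sum.cong) (auto simp: base_def)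
      finally show "(\<Sum>x\<in>{1..n} - {i, Suc N}. base x) = 1 - (1 - ?s)" by simp
      show "hard_mass N (h(i := y)) (Suc N) = 1 - ?s - y" for y
        unfolding hard_mass_def sum_upd by simp
    qed (use N h in \<open>auto simp: hard_mass_def base_def\<close>)
    then obtain P where P: "\<And>y. formal_accept n f (hard_mass N (h(i := y))) alg = poly P y"
      "\<And>k. \<bar>coeff P k\<bar> \<le> 2 ^ k * real (q choose k)" by blast
    have "g C alg = measure_pmf.expectation C (poly P)" if "set_pmf C \<subseteq> {0..u}" for C
      unfolding g_def pmf_bind
    proof (intro integral_cong_AE)
      have "pmf (map_pmf snd (exec (?D y) f alg)) True = poly P y" if "y \<in> {0..u}" for y
        by (simp only: pmf_exec_eq_formal_accept[OF hard_dist_in_distributions[OF N(1)]] mass[OF that] P(1))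
      thus "AE y in measure_pmf C. pmf (map_pmf snd (exec (?D y) f alg)) True = poly P y"
        using that by (auto simp: AE_measure_pmf_iff)
    qed auto
    thus ?thesis
      using expectation_poly_close[OF fin supp moments P(2) small u(1)] supp by simp
  qed
  have int: "integrable (measure_pmf T) (g C)" for C
    by (rule measure_pmf.integrable_const_bound[where B = 1]) (auto simp: g_def pmf_le_1)
  have "\<bar>measure_pmf.expectation T (g A) - measure_pmf.expectation T (g B)\<bar>
      = \<bar>measure_pmf.expectation T (\<lambda>alg. g A alg - g B alg)\<bar>"
    by (simp add: int)
  also have "\<dots> \<le> measure_pmf.expectation T (\<lambda>alg. \<bar>g A alg - g B alg\<bar>)"
    by (rule integral_abs_bound)
  also have "\<dots> \<le> measure_pmf.expectation T (\<lambda>alg. exp (- real M))"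
    using int alg by (intro integral_mono_AE) (auto simp: AE_measure_pmf_iff)
  finally show ?thesis by (simp add: swap)
qed

text \<open>Exponential moment with parameter 1/u: the means add up to at most 1/8, which
  contributes 1/(4u) against the threshold 3/(4u).\<close>

lemma sum_exceeds_three_quarters:
  fixes P :: "nat \<Rightarrow> real pmf"
  assumes "finite I" "card I \<le> N" "0 < u"
    and P: "\<And>i. i \<in> I \<Longrightarrow> finite (set_pmf (P i))" "\<And>i. i \<in> I \<Longrightarrow> set_pmf (P i) \<subseteq> {0..u}"
      "\<And>i. i \<in> I \<Longrightarrow> measure_pmf.expectation (P i) (\<lambda>y. y) \<le> 1 / (8 * real N)"
  shows "measure_pmf.prob (Pi_pmf I d P) {h. 3/4 < (\<Sum>i\<in>I. h i)} \<le> exp (- 1 / (2 * u))"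
proof (cases "N = 0")
  case False
  have "measure_pmf.prob (Pi_pmf I d P) {h. 3/4 < (\<Sum>i\<in>I. h i)}
      \<le> measure_pmf.prob (Pi_pmf I d P) {h. 3 / (4 * u) \<le> (\<Sum>i\<in>I. h i / u)}"
    using assms(3) by (intro measure_pmf.finite_measure_mono)
      (auto simp: divide_simps simp flip: sum_divide_distrib)
  also have "\<dots> \<le> exp (real (card I) * (2 * (1 / (8 * real N)) / u) - 3 / (4 * u))"
    by (intro Pi_pmf_sum_tail expectation_exp_scaled_le assms)
  also have "\<dots> \<le> exp (real N * (2 * (1 / (8 * real N)) / u) - 3 / (4 * u))"
    using assms(2,3) by (intro exp_le_cancel_iff[THEN iffD2] diff_right_mono mult_right_mono) auto
  also have "real N * (2 * (1 / (8 * real N)) / u) - 3 / (4 * u) = - 1 / (2 * u)"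
    using False assms(3) by (simp add: field_simps)
  finally show ?thesis .
next
  case True
  thus ?thesis using assms by simp
qed

text \<open>Serves to discard an exceptional event \<open>S\<close> at the cost of its
  probability.\<close>

lemma expectation_le_const_plus_prob:
  fixes g :: "'a \<Rightarrow> real"
  assumes "\<And>x. g x \<in> {0..1}" "\<And>x. x \<in> set_pmf p \<Longrightarrow> g x \<le> a + indicator S x"
  shows "measure_pmf.expectation p g \<le> a + measure_pmf.prob p S"
proof -
  have g: "integrable (measure_pmf p) g"
    using assms(1) by (intro measure_pmf.integrable_const_bound[where B = 1]) auto
  have S: "integrable (measure_pmf p) (indicator S :: 'a \<Rightarrow> real)"
    by (intro measure_pmf.integrable_const_bound[where B = 1]) auto
  have "measure_pmf.expectation p g \<le> measure_pmf.expectation p (\<lambda>x. a + indicator S x)"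
    using assms(2) g S by (intro integral_mono_AE) (auto simp: AE_measure_pmf_iff)
  also have "\<dots> = a + measure_pmf.prob p S"
    using S by (subst Bochner_Integration.integral_add) auto
  finally show ?thesis .
qed

text \<open>Masses from \<open>A\<close> mostly give distance 0 and masses from \<open>B\<close>
  mostly distance at least \<epsilon>, so the average acceptance probabilities differ by almost 1/3;
  the hybrid argument bounds that difference from above.\<close>

lemma tolerant_tester_tradeoff:
  assumes T: "df_tolerant_tester n \<epsilon> (small_class n) q T"
    and N: "Suc N \<le> n" "N \<ge> 1" "47/48 * real N + 1 \<le> real n / 5"
    and eps: "0 < \<epsilon>" "\<epsilon> \<le> (real N - real n / 5) / (160 * real N)"
    and M: "M \<ge> 1" "(real M)\<^sup>2 / (40 * real N) \<le> 1/4"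
      "real q * (2 * ((real M)\<^sup>2 / (40 * real N))) * exp 2 \<le> real M"
  shows "1/3 \<le> exp (- real N / 48) + exp (- 20 * real N / (real M)\<^sup>2)
      + real N * (exp (- real M) + exp (- 20 * real N / (real M)\<^sup>2))"
proof -
  define u where "u = (real M)\<^sup>2 / (40 * real N)"
  \<comment> \<open>Scaling by \<open>40 * N\<close> turns the mean bound 5 into
    \<open>1 / (8 * N)\<close>, so the expected total is at most 1/8, and the lower bound 1/4 on the
    support of \<open>B0\<close> into \<open>1 / (160 * N)\<close>.\<close>
  define sc where "sc = (\<lambda>x. x / (40 * real N))"
  obtain A0 B0 :: "real pmf" where
    fin0: "finite (set_pmf A0)" "finite (set_pmf B0)" and
    supp0: "set_pmf A0 \<subseteq> {0..(real M)\<^sup>2}" "set_pmf B0 \<subseteq> {1/4..(real M)\<^sup>2}" and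
    zero0: "pmf A0 0 \<ge> 1/12" and
    mom0: "\<And>k. k < M \<Longrightarrow> measure_pmf.expectation A0 (\<lambda>y. y ^ k) = measure_pmf.expectation B0 (\<lambda>y. y ^ k)" and
    mean0: "measure_pmf.expectation A0 (\<lambda>y. y) \<le> 5" "measure_pmf.expectation B0 (\<lambda>y. y) \<le> 5"
    by (rule ex_pmfs_matching_moments[OF M(1)]) blast
  define A where "A = map_pmf sc A0"
  define B where "B = map_pmf sc B0"
  have N0: "real N > 0" using N(2) by simp
  have u: "0 < u" "u \<le> 1/4" using M N0 by (auto simp: u_def)
  have exp_u: "exp (- 1 / (2 * u)) = exp (- 20 * real N / (real M)\<^sup>2)"
    using N0 M(1) by (simp add: u_def field_simps)
  have fin: "finite (set_pmf A)" "finite (set_pmf B)" using fin0 by (auto simp: A_def B_def)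
  have sc_range: "sc x \<in> {0..u}" if "x \<in> {0..(real M)\<^sup>2}" for x
    using that N0 by (auto simp: sc_def u_def divide_right_mono)
  have supp: "set_pmf A \<subseteq> {0..u}" "set_pmf B \<subseteq> {0..u}"
    using supp0 sc_range by (force simp: A_def B_def)+
  have suppB: "1 / (160 * real N) \<le> y" if "y \<in> set_pmf B" for y
  proof -
    from that obtain x where x: "x \<in> set_pmf B0" "y = x / (40 * real N)" by (auto simp: B_def sc_def)
    have "(1/4) / (40 * real N) \<le> x / (40 * real N)"
      using x supp0(2) N0 by (intro divide_right_mono) auto
    thus ?thesis using x(2) by simp
  qed
  have mom: "measure_pmf.expectation A (\<lambda>y. y ^ k) = measure_pmf.expectation B (\<lambda>y. y ^ k)"
    if "k < M" for k
    using mom0[OF that] by (simp add: A_def B_def sc_def power_divide)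
  have mean: "measure_pmf.expectation A (\<lambda>y. y) \<le> 1 / (8 * real N)"
    "measure_pmf.expectation B (\<lambda>y. y) \<le> 1 / (8 * real N)"
    using mean0 N0 by (auto simp: A_def B_def sc_def field_simps)
  have zero: "pmf A 0 \<ge> 1/12"
  proof -
    have "sc -` {0} = {0}" using N0 by (auto simp: sc_def)
    thus ?thesis using zero0 by (simp add: A_def pmf_map measure_pmf_single)
  qed

  let ?f = "all_ones n" and ?I = "{1..N}"
  let ?K = "\<lambda>V. verdict_pmf T (hard_dist N V) ?f"
  define F where "F P = pmf (bind_pmf (Pi_pmf ?I 0 P) ?K) True" for P
  have query: "query_algorithm n q T" and
    acc: "\<And>D. D \<in> distributions n \<Longrightarrow> dist_class D ?f (small_class n) = 0 \<Longrightarrow> accept_prob T D ?f \<ge> 2/3" and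
    rej: "\<And>D. D \<in> distributions n \<Longrightarrow> dist_class D ?f (small_class n) \<ge> \<epsilon> \<Longrightarrow> reject_prob T D ?f \<ge> 2/3"
    using T all_ones_in_bool_funs by (auto simp: df_tolerant_tester_def)

  have step: "\<bar>F (P(i := A)) - F (P(i := B))\<bar> \<le> exp (- real M) + exp (- 1 / (2 * u))"
    if i: "i \<in> ?I" and P: "\<And>j. P j \<in> {A, B}" for P i
  proof -
    let ?J = "?I - {i}"
    let ?H = "Pi_pmf ?J 0 P"
    define G where "G C h = pmf (bind_pmf C (\<lambda>y. ?K (h(i := y)))) True" for C h
    \<comment> \<open>Coordinate \<open>i\<close> is drawn independently of the rest, so both
      hybrids share the distribution \<open>?H\<close> of the other coordinates and can be compared
      pointwise.\<close>
    have F: "F (P(i := C)) = measure_pmf.expectation ?H (G C)" for C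
    proof -
      have "Pi_pmf ?I 0 (P(i := C)) = Pi_pmf (insert i ?J) 0 (P(i := C))" using i by (simp add: insert_absorb)
      also have "\<dots> = bind_pmf C (\<lambda>y. bind_pmf (Pi_pmf ?J 0 (P(i := C))) (\<lambda>h. return_pmf (h(i := y))))"
        by (subst Pi_pmf_insert') auto
      also have "Pi_pmf ?J 0 (P(i := C)) = ?H" by (intro Pi_pmf_cong) auto
      finally have "bind_pmf (Pi_pmf ?I 0 (P(i := C))) ?K = bind_pmf C (\<lambda>y. bind_pmf ?H (\<lambda>h. ?K (h(i := y))))"
        by (simp only: bind_assoc_pmf bind_return_pmf)
      also have "\<dots> = bind_pmf ?H (\<lambda>h. bind_pmf C (\<lambda>y. ?K (h(i := y))))"
        by (rule bind_commute_pmf)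
      finally have "F (P(i := C)) = pmf (bind_pmf ?H (\<lambda>h. bind_pmf C (\<lambda>y. ?K (h(i := y))))) True"
        unfolding F_def by (rule arg_cong)
      also have "\<dots> = measure_pmf.expectation ?H (G C)"
        unfolding G_def by (rule pmf_bind)
      finally show ?thesis .
    qed
    have PAB: "finite (set_pmf (P j))" "set_pmf (P j) \<subseteq> {0..u}"
      "measure_pmf.expectation (P j) (\<lambda>y. y) \<le> 1 / (8 * real N)" for j
      using P[of j] fin supp mean by auto
    have bad: "measure_pmf.prob ?H {h. 3/4 < (\<Sum>j\<in>?J. h j)} \<le> exp (- 1 / (2 * u))"
      by (rule sum_exceeds_three_quarters[where N = N]) (use PAB i u in auto)
    have G01: "G C h \<in> {0..1}" for C h by (simp add: G_def pmf_le_1)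
    have int: "integrable (measure_pmf ?H) (G C)" for C
      by (rule measure_pmf.integrable_const_bound[where B = 1]) (use G01 in auto)
    let ?bad = "{h. 3/4 < (\<Sum>j\<in>?J. h j)}"
    have pt: "\<bar>G A h - G B h\<bar> \<le> exp (- real M) + indicator ?bad h" if h: "h \<in> set_pmf ?H" for h
    proof (cases "h \<in> ?bad")
      case True
      have "\<bar>G A h - G B h\<bar> \<le> 1" using G01[of A h] G01[of B h] by auto
      moreover have "indicator ?bad h = (1::real)" using True by (rule indicator_simps)
      ultimately show ?thesis using exp_ge_zero[of "- real M"] by linarith
    next
      case False
      have "0 \<le> h j" if "j \<in> ?J" for j
      proof -
        have "h j \<in> set_pmf (P j)"
          using h that by (auto simp: set_Pi_pmf PiE_dflt_def)
        thus ?thesis using PAB(2)[of j] by auto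
      qed
      thus ?thesis
        unfolding G_def
        using False verdict_hard_dist_close[OF query all_ones_in_bool_funs N(1) i fin supp mom
            M(3)[folded u_def] less_imp_le[OF u(1)] u(2)] by simp
    qed
    have "\<bar>F (P(i := A)) - F (P(i := B))\<bar> = \<bar>measure_pmf.expectation ?H (\<lambda>h. G A h - G B h)\<bar>"
      by (simp only: F Bochner_Integration.integral_diff[OF int int])
    also have "\<dots> \<le> measure_pmf.expectation ?H (\<lambda>h. \<bar>G A h - G B h\<bar>)"
      by (rule integral_abs_bound)
    also have "\<dots> \<le> exp (- real M) + measure_pmf.prob ?H ?bad"
    proof (rule expectation_le_const_plus_prob)
      show "\<bar>G A h - G B h\<bar> \<in> {0..1}" for h using G01[of A h] G01[of B h] by auto
    qed (rule pt)
    finally show ?thesis using bad by linarith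
  qed
  have hybrid: "\<bar>F (\<lambda>_. A) - F (\<lambda>_. B)\<bar> \<le> real N * (exp (- real M) + exp (- 1 / (2 * u)))"
  proof -
    \<comment> \<open>The hybrids end with \<open>A\<close> outside \<open>?I\<close>, which the
      product over \<open>?I\<close> does not see.\<close>
    have "F (\<lambda>j. if j \<in> ?I then B else A) = F (\<lambda>_. B)"
      unfolding F_def by (intro arg_cong[where f = "\<lambda>p. pmf (bind_pmf p ?K) True"] Pi_pmf_cong) auto
    thus ?thesis
      using hybrid_argument[of ?I A B F "exp (- real M) + exp (- 1 / (2 * u))", OF _ step] by simp
  qed

  have accA: "2/3 - exp (- real N / 48) \<le> F (\<lambda>_. A)"
  proof -
    let ?H = "Pi_pmf ?I 0 (\<lambda>_. A)"
    \<comment> \<open>The event of at most N/48 zeros. With \<open>pmf A 0\<close> at least 1/12 the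
      exponent is -N/24 + N/48. Outside it fewer than 47N/48 points keep positive mass, which with
      the extra point is at most n/5.\<close>
    define few :: "(nat \<Rightarrow> real) set" where "few = {V. - real N / 48 \<le> (\<Sum>i\<in>?I. - of_bool (V i = 0))}"
    have "measure_pmf.prob ?H few \<le> exp (real (card ?I) * (- (1/12) / 2) - (- real N / 48))"
      unfolding few_def
      by (rule Pi_pmf_sum_tail[where g = "\<lambda>y. - of_bool (y = 0)"])
         (simp_all only: finite_atLeastAtMost fin expectation_exp_minus_zero_le[OF zero])
    also have "real (card ?I) * (- (1/12) / 2) - (- real N / 48) = - real N / 48" by simp
    finally have few: "measure_pmf.prob ?H few \<le> exp (- real N / 48)" .
    have pt: "1 - pmf (?K V) True \<le> 1/3 + indicator few V" for V
    proof (cases "V \<in> few")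
      case True
      hence "indicator few V = (1::real)" by (rule indicator_simps)
      thus ?thesis using pmf_nonneg[of "?K V" True] by linarith
    next
      case False
      have "(\<Sum>i\<in>?I. - of_bool (V i = 0) :: real) = - real (card {i\<in>?I. V i = 0})"
        by (simp only: real_of_card sum.inter_filter finite_atLeastAtMost of_bool_def sum_negf)
      moreover have "(\<Sum>i\<in>?I. - of_bool (V i = 0) :: real) < - real N / 48"
        using False by (simp only: few_def mem_Collect_eq not_le)
      ultimately have "real N / 48 < real (card {i\<in>?I. V i = 0})" by linarith
      moreover have "card ?I = card {i\<in>?I. V i = 0} + card {i\<in>?I. V i \<noteq> 0}"
        by (rule card_filter_split) simp
      ultimately have "real (card {i\<in>?I. V i \<noteq> 0}) + 1 \<le> real n / 5" using N(3) unfolding card_atLeastAtMost by linarith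
      hence "accept_prob T (hard_dist N V) ?f \<ge> 2/3"
        by (intro acc hard_dist_in_distributions dist_class_all_ones_eq_0 N)
      moreover have "indicator few V = (0::real)" using False by (rule indicator_simps)
      ultimately show ?thesis unfolding accept_prob_def by linarith
    qed
    have "measure_pmf.expectation ?H (\<lambda>V. 1 - pmf (?K V) True) \<le> 1/3 + measure_pmf.prob ?H few"
      by (rule expectation_le_const_plus_prob) (simp add: pmf_le_1, rule pt)
    moreover have "measure_pmf.expectation ?H (\<lambda>V. 1 - pmf (?K V) True) = 1 - F (\<lambda>_. A)"
      unfolding F_def pmf_bind
      by (subst Bochner_Integration.integral_diff)
         (auto simp: pmf_le_1 intro!: measure_pmf.integrable_const_bound[where B = 1])
    ultimately show ?thesis using few by linarith
  qed

  have accB: "F (\<lambda>_. B) \<le> 1/3 + exp (- 1 / (2 * u))"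
  proof -
    let ?H = "Pi_pmf ?I 0 (\<lambda>_. B)"
    define bad :: "(nat \<Rightarrow> real) set" where "bad = {V. 3/4 < (\<Sum>i\<in>?I. V i)}"
    have prob_bad: "measure_pmf.prob ?H bad \<le> exp (- 1 / (2 * u))"
      unfolding bad_def
      by (rule sum_exceeds_three_quarters[OF _ _ u(1) fin(2) supp(2) mean(2)]) simp_all
    have pt: "pmf (?K V) True \<le> 1/3 + indicator bad V" if V: "V \<in> set_pmf ?H" for V
    proof (cases "V \<in> bad")
      case True
      hence "indicator bad V = (1::real)" by (rule indicator_simps)
      thus ?thesis using pmf_le_1[of "?K V" True] by linarith
    next
      case False
      have VB: "V i \<in> set_pmf B" if "i \<in> ?I" for i
        using V that by (auto simp: set_Pi_pmf PiE_dflt_def)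
      \<comment> \<open>Outside \<open>bad\<close> the masses form a genuine distribution, and none
        of them is below \<open>1 / (160 * N)\<close>.\<close>
      have "dist_class (hard_dist N V) ?f (small_class n) \<ge> \<epsilon>"
      proof (rule dist_class_all_ones_ge[OF N(1), where w = "1 / (160 * real N)"])
        show "1 / (160 * real N) \<le> V i" if "i \<in> ?I" for i using suppB VB[OF that] .
        show "(\<Sum>i\<in>?I. V i) \<le> 1" using False by (simp add: bad_def)
        show "\<epsilon> \<le> (real N - real n / 5) * (1 / (160 * real N))" using eps(2) by simp
      qed simp
      hence "reject_prob T (hard_dist N V) ?f \<ge> 2/3"
        by (intro rej hard_dist_in_distributions N)
      thus ?thesis using False unfolding reject_prob_def pmf_False_conv_True by simp
    qed
    have "F (\<lambda>_. B) \<le> 1/3 + measure_pmf.prob ?H bad"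
      unfolding F_def pmf_bind[of ?H]
    proof (rule expectation_le_const_plus_prob)
      show "pmf (?K V) True \<in> {0..1}" for V by (simp add: pmf_le_1)
    qed (rule pt)
    thus ?thesis using prob_bad by linarith
  qed
  show ?thesis using hybrid accA accB unfolding exp_u by linarith
qed

section \<open>Choice of parameters and small domains\<close>

text \<open>Without requests the two constant functions get the same verdict distribution, yet under
  the uniform distribution their distances are 0 and at least 4/5. This settles the small
  \<open>n\<close>.\<close>

lemma tolerant_tester_needs_request:
  assumes T: "df_tolerant_tester n \<epsilon> (small_class n) q T" and "n \<ge> 2" "0 < \<epsilon>" "\<epsilon> \<le> 4/5"
  shows "q \<ge> 1"
proof (rule ccontr)
  assume "\<not> q \<ge> 1"
  hence q: "q = 0" by simp
  let ?U = "pmf_of_set {1..n}"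
  let ?z = "(\<lambda>x\<in>{1..n}. False)"
  have U: "?U \<in> distributions n" using assms(2) by (simp add: distributions_def)
  have z: "?z \<in> small_class n" "?z \<in> bool_funs n"
    using all_false_in_small_class[of n] by (auto simp: small_class_def)
  have verdict: "map_pmf snd (exec ?U f A) = map_pmf snd (exec ?U g A)"
    if "A \<in> set_pmf T" "f \<in> bool_funs n" "g \<in> bool_funs n" for f g A
  proof -
    have "depth_le n f A 0"
      using depth_le_query_algorithm[of n q T A f] T that assms(2) q
      by (simp add: df_tolerant_tester_def)
    thus ?thesis by (cases A) auto
  qed
  have eq: "verdict_pmf T ?U ?z = verdict_pmf T ?U (all_ones n)"
    unfolding verdict_pmf_def
    by (intro bind_pmf_cong refl verdict z all_ones_in_bool_funs)
  have "dist_class ?U ?z (small_class n) = 0"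
  proof -
    have "dist_class ?U ?z (small_class n) \<le> 0"
      using dist_class_le[OF z(1), of ?U ?z] by (simp add: dist_fun_def)
    moreover have "0 \<le> dist_class ?U ?z (small_class n)"
      unfolding dist_class_def using z finite_small_class
      by (subst Min_ge_iff) (auto simp: dist_fun_def)
    ultimately show ?thesis by simp
  qed
  hence "accept_prob T ?U ?z \<ge> 2/3" using T U z by (auto simp: df_tolerant_tester_def)
  moreover have "dist_class ?U (all_ones n) (small_class n) \<ge> \<epsilon>"
  proof -
    have "\<epsilon> \<le> dist_fun ?U (all_ones n) h" if h: "h \<in> small_class n" for h
    proof -
      let ?Z = "{i\<in>{1..n}. \<not> h i}"
      have "card {1..n} = card {i\<in>{1..n}. h i} + card ?Z" by (rule card_filter_split) simp
      moreover have "real (card {i\<in>{1..n}. h i}) \<le> real n / 5" using h by (simp add: small_class_def)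
      ultimately have "4/5 \<le> real (card ?Z) / real n" using assms(2) by (simp add: field_simps)
      also have "real (card ?Z) / real n = dist_fun ?U (all_ones n) h"
        using assms(2) by (auto simp: dist_fun_def measure_pmf_of_set all_ones_def
            intro!: arg_cong[where f = card])
      finally show ?thesis using assms(4) by simp
    qed
    thus ?thesis
      unfolding dist_class_def using finite_small_class z by (subst Min_ge_iff) auto
  qed
  hence "reject_prob T ?U (all_ones n) \<ge> 2/3"
    using T U all_ones_in_bool_funs by (auto simp: df_tolerant_tester_def)
  ultimately show False
    unfolding accept_prob_def reject_prob_def eq by (simp add: pmf_False_conv_True)
qed

text \<open>\<open>n * exp (-2 * ln n)\<close> is 1/n, and n / (ln n)^2 outgrows ln n, so all error
  terms vanish in the limit.\<close>

lemma eventually_tradeoff_error_small: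
  "\<forall>\<^sub>F n in at_top. real n \<ge> 2000 \<and>
     ln (real n) \<ge> 1 \<and> (3 * ln (real n))\<^sup>2 / (8 * real n) \<le> 1/4 \<and>
     exp (- real n / 240) + exp (- 4 * real n / (3 * ln (real n))\<^sup>2)
      + real n * (exp (- 2 * ln (real n)) + exp (- 4 * real n / (3 * ln (real n))\<^sup>2)) < 1/3"
  by (intro eventually_conj; real_asymp)

lemma tolerant_tester_lower_bound:
  assumes T: "df_tolerant_tester n \<epsilon> (small_class n) q T" and "0 < \<epsilon>" "\<epsilon> < 1/40000"
    and n: "real n \<ge> 2000" and ln: "ln (real n) \<ge> 1"
    and vol: "(3 * ln (real n))\<^sup>2 / (8 * real n) \<le> 1/4"
    and err: "exp (- real n / 240) + exp (- 4 * real n / (3 * ln (real n))\<^sup>2)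
      + real n * (exp (- 2 * ln (real n)) + exp (- 4 * real n / (3 * ln (real n))\<^sup>2)) < 1/3"
  shows "real q \<ge> 1/10 * (real n / ln (real n))"
proof (rule ccontr)
  assume "\<not> ?thesis"
  hence q: "real q * ln (real n) < real n / 10" using ln by (simp add: field_simps)
  \<comment> \<open>One percent above n/5: under \<open>B\<close> the excess N - n/5 is about n/500,
    while 47/48 of \<open>N\<close> still falls below n/5. \<open>M\<close> is about 2 ln n, so the
    hybrid error \<open>N * exp (-M)\<close> is at most 1/n.\<close>
  define N where "N = nat \<lfloor>101 * real n / 500\<rfloor>"
  define M where "M = nat \<lceil>2 * ln (real n)\<rceil>"
  have N: "real N \<le> 101 * real n / 500" "real N > 101 * real n / 500 - 1"
    unfolding N_def using n by linarith+
  have M: "2 * ln (real n) \<le> real M" "real M \<le> 3 * ln (real n)"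
    unfolding M_def using ln by linarith+
  have N5: "real n / 5 \<le> real N" "real N \<le> real n" using N n by simp_all
  have M1: "M \<ge> 1" using M(1) ln by linarith
  have M2: "(real M)\<^sup>2 \<le> (3 * ln (real n))\<^sup>2" using M by (intro power_mono) auto
  have M2pos: "(real M)\<^sup>2 > 0" using M1 by simp
  have Npos: "0 < real N" using N5(1) n by simp
  have exp2: "exp 2 \<le> (9::real)"
  proof -
    have "exp 2 = exp 1 * exp (1::real)" by (simp flip: exp_add)
    also have "\<dots> \<le> 3 * 3" using exp_le by (intro mult_mono) auto
    finally show ?thesis by simp
  qed
  have "1/3 \<le> exp (- real N / 48) + exp (- 20 * real N / (real M)\<^sup>2)
      + real N * (exp (- real M) + exp (- 20 * real N / (real M)\<^sup>2))"
  proof (rule tolerant_tester_tradeoff[OF T])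
    show "Suc N \<le> n" "N \<ge> 1" "47/48 * real N + 1 \<le> real n / 5" using N n by linarith+
    show "0 < \<epsilon>" by fact
    \<comment> \<open>The right side is below n/1000, whereas N - n/5 exceeds n/500 - 1, at least
      3n/2000 once n is at least 2000.\<close>
    have "\<epsilon> * (160 * real N) \<le> 1/40000 * (160 * (101 * real n / 500))"
      using assms(2,3) N by (intro mult_mono) auto
    also have "\<dots> \<le> real N - real n / 5" using N(2) n by simp
    finally show "\<epsilon> \<le> (real N - real n / 5) / (160 * real N)"
      using Npos by (simp add: pos_le_divide_eq)
    show "M \<ge> 1" by fact
    have "(real M)\<^sup>2 / (40 * real N) \<le> (3 * ln (real n))\<^sup>2 / (8 * real n)"
      using M2 N5 n by (intro frac_le) auto
    thus "(real M)\<^sup>2 / (40 * real N) \<le> 1/4" using vol by linarith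
    \<comment> \<open>The assumed bound on \<open>q\<close> and M \<le> 3 ln n give q M \<le> 3n/10;
      with \<open>exp 2\<close> at most 9 the quantity to be bounded is then at most 27/40 of
      \<open>M\<close>.\<close>
    have "real q * real M \<le> real q * (3 * ln (real n))" using M(2) by (intro mult_left_mono) auto
    also have "\<dots> \<le> 3 / 2 * real N" using q N5(1) by simp
    finally have qM: "real q * real M \<le> 3 / 2 * real N" .
    have "real q * (2 * ((real M)\<^sup>2 / (40 * real N))) * exp 2
        \<le> real q * (2 * ((real M)\<^sup>2 / (40 * real N))) * 9"
      using exp2 Npos by (intro mult_left_mono) auto
    also have "\<dots> = (real q * real M) * (9 * real M / (20 * real N))"
      by (simp add: power2_eq_square)
    also have "\<dots> \<le> (3 / 2 * real N) * (9 * real M / (20 * real N))"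
      using qM Npos by (intro mult_right_mono) auto
    also have "\<dots> \<le> real M" using Npos by simp
    finally show "real q * (2 * ((real M)\<^sup>2 / (40 * real N))) * exp 2 \<le> real M" .
  qed
  also have "\<dots> \<le> exp (- real n / 240) + exp (- 4 * real n / (3 * ln (real n))\<^sup>2)
      + real n * (exp (- 2 * ln (real n)) + exp (- 4 * real n / (3 * ln (real n))\<^sup>2))"
  proof -
    have 1: "exp (- real N / 48) \<le> exp (- real n / 240)" using N5(1) by simp
    have "4 * real n / (3 * ln (real n))\<^sup>2 \<le> 20 * real N / (real M)\<^sup>2"
      using N5(1) M2 M2pos by (intro frac_le) auto
    hence 2: "exp (- 20 * real N / (real M)\<^sup>2) \<le> exp (- 4 * real n / (3 * ln (real n))\<^sup>2)" by simp
    have 3: "exp (- real M) \<le> exp (- 2 * ln (real n))" using M(1) by simp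
    show ?thesis using N5(2) by (intro add_mono mult_mono 1 2 3) auto
  qed
  finally show False using err by linarith
qed

theorem theorem7p5:
  "(\<exists>C::real. \<forall>n\<ge>2. \<forall>\<epsilon>::real. 0 < \<epsilon> \<and> \<epsilon> < 1 \<longrightarrow>
      (\<exists>T q. df_tester n \<epsilon> (small_class n) q T \<and> nonadaptive n T \<and> real q \<le> C / \<epsilon>\<^sup>2))
   \<and>
   (\<exists>c>0. \<exists>\<epsilon>\<^sub>0>0. \<forall>n\<ge>2. \<forall>\<epsilon>::real. 0 < \<epsilon> \<and> \<epsilon> < \<epsilon>\<^sub>0 \<longrightarrow>
      (\<forall>T q. df_tolerant_tester n \<epsilon> (small_class n) q T \<longrightarrow>
             real q \<ge> c * (real n / ln (real n))))"
proof (intro conjI)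
  show "\<exists>C::real. \<forall>n\<ge>2. \<forall>\<epsilon>::real. 0 < \<epsilon> \<and> \<epsilon> < 1 \<longrightarrow>
      (\<exists>T q. df_tester n \<epsilon> (small_class n) q T \<and> nonadaptive n T \<and> real q \<le> C / \<epsilon>\<^sup>2)"
    using small_class_tester by blast
  obtain n0 where n0: "\<And>n. n \<ge> n0 \<Longrightarrow> real n \<ge> 2000 \<and>
     ln (real n) \<ge> 1 \<and> (3 * ln (real n))\<^sup>2 / (8 * real n) \<le> 1/4 \<and>
     exp (- real n / 240) + exp (- 4 * real n / (3 * ln (real n))\<^sup>2)
      + real n * (exp (- 2 * ln (real n)) + exp (- 4 * real n / (3 * ln (real n))\<^sup>2)) < 1/3"
    using eventually_tradeoff_error_small unfolding eventually_at_top_linorder by blast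
  \<comment> \<open>For n below \<open>n0\<close> the ratio n / ln n is at most (n0 + 1) / ln 2, so
    this \<open>c\<close> makes the claimed bound at most 1, and one request is always
    necessary.\<close>
  define c where "c = min (1/10) (ln 2 / (real n0 + 1))"
  have c: "c \<le> 1/10" "c \<le> ln 2 / (real n0 + 1)"
    unfolding c_def by (rule min.cobounded1 min.cobounded2)+
  have "c * (real n / ln (real n)) \<le> real q"
    if "n \<ge> 2" "0 < \<epsilon>" "\<epsilon> < 1/40000" "df_tolerant_tester n \<epsilon> (small_class n) q T" for n \<epsilon> q T
  proof (cases "n \<ge> n0")
    case True
    have "c * (real n / ln (real n)) \<le> 1/10 * (real n / ln (real n))"
      using that(1) c(1) by (intro mult_right_mono) auto
    also have "\<dots> \<le> real q"
      using tolerant_tester_lower_bound[OF that(4,2,3)] n0[OF True] by blast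
    finally show ?thesis .
  next
    case False
    have "c * (real n / ln (real n)) \<le> ln 2 / (real n0 + 1) * ((real n0 + 1) / ln 2)"
      using that(1) False c(2) by (intro mult_mono frac_le) auto
    also have "\<dots> = 1" by simp
    also have "1 \<le> real q"
      using tolerant_tester_needs_request[OF that(4,1,2)] that(3) by simp
    finally show ?thesis .
  qed
  moreover have "c > 0" by (simp add: c_def)
  moreover have "(1/40000 :: real) > 0" by simp
  ultimately show "\<exists>c>0. \<exists>\<epsilon>\<^sub>0>0. \<forall>n\<ge>2. \<forall>\<epsilon>::real. 0 < \<epsilon> \<and> \<epsilon> < \<epsilon>\<^sub>0 \<longrightarrow>
      (\<forall>T q. df_tolerant_tester n \<epsilon> (small_class n) q T \<longrightarrow>
             real q \<ge> c * (real n / ln (real n)))"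
    by blast
qed

end
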